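(* Let $A=A(q)$, $B=B(q)$ and $\mathscr P=\mathscr P(q)=E_2(q^5)$, where $E_2(q)=1-24\sum_{n=1}^{\infty}\bigl(\sum_{d\mid n}d\bigr)q^n$. Then $$q\frac{d}{dq}A=\frac1{60}A\bigl(-5A^{10}-66A^5B^5+7B^{10}+5\mathscr P\bigr),$$ $$q\frac{d}{dq}B=\frac1{60}B\bigl(7A^{10}+66A^5B^5-5B^{10}+5\mathscr P\bigr),$$ $$q\frac{d}{dq}\mathscr P=\frac5{12}\bigl(\mathscr P^2-B^{20}+12B^{15}A^5-14B^{10}A^{10}-12B^5A^{15}-A^{20}\bigr).$$
   Context: $q=e^{2\pi i\tau}$ with $\operatorname{Im}\tau>0$, $q^{1/5}=e^{2\pi i\tau/5}$ (so $q\frac{d}{dq}=\frac1{2\pi i}\frac{d}{d\tau}$). $(a;q)_\infty=\prod_{k\ge0}(1-aq^k)$, and fractional powers of $(q;q)_\infty$ are the branches whose power series have constant term $1$. The functions $A$ and $B$ are $$A(q)=q^{1/5}(q;q)_\infty^{-3/5}\sum_{n=-\infty}^{\infty}(-1)^nq^{(5n^2-3n)/2},\qquad B(q)=(q;q)_\infty^{-3/5}\sum_{n=-\infty}^{\infty}(-1)^nq^{(5n^2-n)/2}.$$ *)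

theory Defs
  imports "HOL-Complex_Analysis.Complex_Analysis"
begin

definition nome :: "complex \<Rightarrow> complex" where
  "nome \<tau> = exp (2 * of_real pi * \<i> * \<tau>)"

definition qpoch_inf :: "complex \<Rightarrow> complex \<Rightarrow> complex" where
  "qpoch_inf a q = (\<Prod>k. 1 - a * q ^ k)"

text \<open>
  \<open>qq_powr c q\<close> is \<open>(q;q)\<^sub>\<infinity>\<close> to the power \<open>c\<close>, for \<open>|q| < 1\<close>, on the branch whose power
  series has constant term 1.  Each \<open>1 - q ^ Suc k\<close> lies in the right half-plane, so the sum
  of principal logarithms is the holomorphic logarithm of \<open>(q;q)\<^sub>\<infinity>\<close> on the unit disc that
  vanishes at 0; the principal logarithm of the product itself need not be holomorphic there.
\<close>

definition qq_powr :: "complex \<Rightarrow> complex \<Rightarrow> complex" where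
  "qq_powr c q = exp (c * (\<Sum>k. Ln (1 - q ^ Suc k)))"

definition A_fun :: "complex \<Rightarrow> complex" where
  "A_fun \<tau> = (let q = nome \<tau> in
     exp (2 * of_real pi * \<i> * \<tau> / 5) * qq_powr (-3/5) q *
     (\<Sum>\<^sub>\<infinity>n::int. (-1) powi n * q powi ((5 * n\<^sup>2 - 3 * n) div 2)))"

definition B_fun :: "complex \<Rightarrow> complex" where
  "B_fun \<tau> = (let q = nome \<tau> in
     qq_powr (-3/5) q *
     (\<Sum>\<^sub>\<infinity>n::int. (-1) powi n * q powi ((5 * n\<^sup>2 - n) div 2)))"

definition E2 :: "complex \<Rightarrow> complex" where
  "E2 q = 1 - 24 * (\<Sum>n. of_nat (\<Sum>d | d dvd Suc n. d) * q ^ Suc n)"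

definition P_fun :: "complex \<Rightarrow> complex" where
  "P_fun \<tau> = E2 (nome \<tau> ^ 5)"

text \<open>
  The operator \<open>q d/dq\<close>, for functions given in terms of \<open>\<tau>\<close>, where \<open>q = nome \<tau>\<close>.
\<close>

definition qD :: "(complex \<Rightarrow> complex) \<Rightarrow> complex \<Rightarrow> complex" where
  "qD f \<tau> = deriv f \<tau> / (2 * of_real pi * \<i>)"

text \<open>The following facts identify \<open>qq_powr (-3/5)\<close> as the intended branch.\<close>

lemma one_minus_in_slit:
  fixes q :: complex
  assumes "norm q < 1"
  shows "1 - q ^ Suc k \<notin> \<real>\<^sub>\<le>\<^sub>0" and "1 - q ^ Suc k \<noteq> 0"
proof -
  have "norm (q ^ Suc k) < 1"
    using assms by (simp only: norm_power power_less_one_iff norm_ge_zero)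
       (auto intro: power_less_one_iff[THEN iffD2])
  hence "Re (1 - q ^ Suc k) > 0"
    using complex_Re_le_cmod[of "q ^ Suc k"] by simp
  thus "1 - q ^ Suc k \<notin> \<real>\<^sub>\<le>\<^sub>0" "1 - q ^ Suc k \<noteq> 0"
    by (auto simp: complex_nonpos_Reals_iff simp del: power_Suc)
qed

lemma uniform_limit_log:
  assumes "0 < r" "r < 1"
  shows "uniform_limit (cball 0 r) (\<lambda>n q. \<Sum>k<n. Ln (1 - q ^ Suc k))
           (\<lambda>q. \<Sum>k. Ln (1 - q ^ Suc k)) sequentially"
proof (rule Weierstrass_m_test_ev[where M = "\<lambda>k. 2 * r ^ Suc k"])
  have "(\<lambda>k. r ^ Suc k) \<longlonglongrightarrow> 0"
    using assms by (intro LIMSEQ_Suc LIMSEQ_power_zero) auto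
  hence "\<forall>\<^sub>F k in sequentially. r ^ Suc k < 1/2"
    by (rule order_tendstoD) auto
  thus "\<forall>\<^sub>F k in sequentially. \<forall>q\<in>cball 0 r. norm (Ln (1 - q ^ Suc k)) \<le> 2 * r ^ Suc k"
  proof eventually_elim
    case (elim k)
    show ?case
    proof
      fix q :: complex assume "q \<in> cball 0 r"
      hence le: "norm (q ^ Suc k) \<le> r ^ Suc k"
        unfolding norm_power by (intro power_mono) auto
      hence "norm (Ln (1 + - (q ^ Suc k))) \<le> 2 * norm (- (q ^ Suc k))"
        using elim by (intro norm_Ln_le) (simp del: power_Suc)
      thus "norm (Ln (1 - q ^ Suc k)) \<le> 2 * r ^ Suc k"
        using le by (simp del: power_Suc)
    qed
  qed
  show "summable (\<lambda>k. 2 * r ^ Suc k)"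
    using assms by (intro summable_mult, subst summable_Suc_iff) (auto intro: summable_geometric)
qed

lemma summable_log:
  assumes "norm q < 1"
  shows "summable (\<lambda>k. Ln (1 - q ^ Suc k))"
proof -
  define r where "r = (norm q + 1) / 2"
  have r: "0 < r" "r < 1" "q \<in> cball 0 r"
    using assms norm_ge_zero[of q] unfolding r_def by (auto simp del: norm_ge_zero)
  show ?thesis
    using tendsto_uniform_limitI[OF uniform_limit_log[OF r(1,2)] r(3)]
    unfolding summable_def sums_def by blast
qed

lemma qq_powr_of_nat:
  assumes "norm q < 1"
  shows "qq_powr (of_nat n) q = qpoch_inf q q ^ n"
proof -
  have "exp (\<Sum>k. Ln (1 - q ^ Suc k)) = (\<Prod>k. exp (Ln (1 - q ^ Suc k)))"
    by (intro prodinf_exp[symmetric] summable_log assms)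
  also have "\<dots> = qpoch_inf q q"
    unfolding qpoch_inf_def using one_minus_in_slit(2)[OF assms] by simp
  finally show ?thesis
    unfolding qq_powr_def by (simp add: exp_of_nat_mult)
qed

lemma qq_powr_0 [simp]: "qq_powr c 0 = 1"
  by (simp add: qq_powr_def)

lemma qq_powr_fifth:
  assumes "norm q < 1"
  shows "qq_powr (-3/5) q ^ 5 * qpoch_inf q q ^ 3 = 1"
  unfolding qq_powr_of_nat[OF assms, symmetric]
  by (simp add: qq_powr_def exp_of_nat_mult[symmetric] exp_add[symmetric])

lemma holomorphic_qq_powr: "qq_powr c holomorphic_on ball 0 1"
proof -
  have "(\<lambda>q. \<Sum>k. Ln (1 - q ^ Suc k)) holomorphic_on ball 0 1"
  proof (rule holomorphic_uniform_sequence[OF open_ball])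
    show "(\<lambda>q. \<Sum>k<n. Ln (1 - q ^ Suc k)) holomorphic_on ball 0 1" for n
      by (intro holomorphic_intros) (use one_minus_in_slit in \<open>auto simp del: power_Suc\<close>)
  next
    fix x :: complex assume x: "x \<in> ball 0 1"
    define d where "d = (1 - norm x) / 2"
    have d: "d > 0" and r: "0 < norm x + d" "norm x + d < 1"
      using x norm_ge_zero[of x] by (auto simp: d_def field_simps simp del: norm_ge_zero)
    have sub: "cball x d \<subseteq> cball 0 (norm x + d)"
      by (simp add: cball_subset_cball_iff)
    also have "\<dots> \<subseteq> ball 0 1"
      using r by auto
    finally show "\<exists>d>0. cball x d \<subseteq> ball 0 1 \<and>
        uniform_limit (cball x d) (\<lambda>n q. \<Sum>k<n. Ln (1 - q ^ Suc k))
          (\<lambda>q. \<Sum>k. Ln (1 - q ^ Suc k)) sequentially"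
      using d uniform_limit_on_subset[OF uniform_limit_log[OF r] sub] by blast
  qed
  thus ?thesis
    unfolding qq_powr_def by (intro holomorphic_intros)
qed

lemma qq_powr_unique:
  assumes cont: "g holomorphic_on ball 0 1" and g0: "g 0 = 1"
    and g: "\<And>q. q \<in> ball 0 1 \<Longrightarrow> g q ^ 5 * qpoch_inf q q ^ 3 = 1"
    and q: "q \<in> ball 0 1"
  shows "g q = qq_powr (-3/5) q"
proof -
  define h where "h = (\<lambda>q. g q / qq_powr (-3/5) q)"
  have nz: "qq_powr (-3/5) z \<noteq> 0" for z
    by (simp add: qq_powr_def)
  have h5: "h z ^ 5 = 1" if z: "z \<in> ball 0 1" for z
  proof -
    have "g z ^ 5 * qpoch_inf z z ^ 3 = qq_powr (-3/5) z ^ 5 * qpoch_inf z z ^ 3"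
      using g[OF z] qq_powr_fifth[of z] z by simp
    moreover have "qpoch_inf z z \<noteq> 0"
      using g[OF z] by auto
    ultimately show ?thesis
      using nz[of z] by (simp add: h_def power_divide)
  qed
  have "continuous_on (ball 0 1) h"
    unfolding h_def
    by (intro continuous_on_divide holomorphic_on_imp_continuous_on cont holomorphic_qq_powr)
       (use nz in auto)
  moreover have "finite (h ` ball 0 1)"
  proof (rule finite_subset)
    show "h ` ball 0 1 \<subseteq> {z. z ^ 5 = 1}"
      using h5 by auto
    show "finite {z::complex. z ^ 5 = 1}"
      by (rule finite_roots_unity) auto
  qed
  ultimately have "h constant_on ball 0 1"
    by (intro continuous_finite_range_constant) auto
  then obtain c where c: "\<And>z. z \<in> ball 0 1 \<Longrightarrow> h z = c"
    by (auto simp: constant_on_def)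
  have "h q = h 0"
    using c[OF q] c[of 0] by simp
  thus ?thesis
    using nz[of q] g0 by (simp add: h_def)
qed

end

theory Submission
  imports Defs
begin

text \<open>
  Write \<open>\<theta>(u, t) = \<Sum>n. (-1)\<^sup>n exp ((n - 1/2)\<^sup>2 t/2 + (n - 1/2) u)\<close> and \<open>q = e\<^sup>s\<close>.  By the triple product,
  the theta series in \<open>A\<close> and \<open>B\<close> are \<open>\<theta>(s, 5s)\<close> and \<open>\<theta>(2s, 5s)\<close> up to powers of \<open>q\<close>, their product is
  \<open>(q;q)(q\<^sup>5;q\<^sup>5)\<close> up to such a power, and \<open>\<theta>'(0, 5s)\<close> is \<open>(q\<^sup>5;q\<^sup>5)\<^sup>3\<close> up to sign and such a power.  Hence \<open>A\<^sup>5\<close> and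
  \<open>B\<^sup>5\<close> are quotients of theta values at 5-torsion points, and the heat equation expresses their
  derivatives through the first two logarithmic derivatives of \<open>\<theta>\<close> there, and through
  \<open>\<theta>'''/\<theta>'\<close> at 0, which is \<open>E\<^sub>2(q\<^sup>5)/4\<close>.

  Let \<open>\<zeta>\<close> and \<open>-\<wp>\<close> be those logarithmic derivatives.  Reindexing a double series gives the addition theorem
  \<open>\<theta>(u+v) \<theta>(u-v) \<theta>'(0)\<^sup>2 = \<theta>(u)\<^sup>2 \<theta>(v)\<^sup>2 (\<wp>(v) - \<wp>(u))\<close>; differentiating its logarithm in \<open>u\<close>, \<open>v\<close> and
  \<open>t\<close> gives \<open>(\<zeta>(u+v) - \<zeta>(u) - \<zeta>(v))\<^sup>2 = \<wp>(u+v) + \<wp>(u) + \<wp>(v)\<close> (with \<open>\<wp>\<close> normalised by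
  \<open>\<theta>'''/\<theta>'\<close>).  At \<open>u = s\<close>, \<open>v = \<plusminus>2s\<close>, \<open>t = 5s\<close> the bases of these squares are \<open>(B\<^sup>5 \<minusplus> A\<^sup>5)/2\<close>, so all
  torsion values of \<open>\<zeta>\<close>, \<open>\<wp>\<close>, \<open>\<wp>'\<close>, \<open>\<wp>''\<close> are polynomials in \<open>A\<^sup>5\<close>, \<open>B\<^sup>5\<close> and \<open>E\<^sub>2(q\<^sup>5)\<close>.
\<close>

section \<open>Theta functions as exponential series\<close>

lemma sums_infsum_int_decode:
  fixes f :: "int \<Rightarrow> complex"
  assumes "f summable_on UNIV"
  shows "(\<lambda>k. f (int_decode k)) sums infsum f UNIV"
proof -
  have "(f has_sum infsum f UNIV) UNIV"
    using assms by (rule has_sum_infsum)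
  hence "((\<lambda>k. f (int_decode k)) has_sum infsum f UNIV) UNIV"
    using has_sum_reindex_bij_betw[OF bij_int_decode, of f "infsum f UNIV"] by simp
  thus ?thesis by (rule has_sum_imp_sums)
qed

lemma summable_int_decode:
  fixes M :: "int \<Rightarrow> real"
  assumes "M summable_on UNIV"
  shows "summable (\<lambda>k. M (int_decode k))"
proof -
  have "(\<lambda>k. M (int_decode k)) summable_on UNIV"
    using assms summable_on_reindex_bij_betw[OF bij_int_decode, of M] by simp
  thus ?thesis by (rule summable_on_imp_summable)
qed

lemma summable_on_norm_bound:
  fixes f :: "int \<Rightarrow> complex"
  assumes "M summable_on UNIV" "\<And>n. norm (f n) \<le> M n"
  shows "f summable_on UNIV"
  by (rule abs_summable_summable, rule Infinite_Sum.abs_summable_on_comparison_test'[OF assms(1)])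
     (use assms(2) in auto)

text \<open>Transport along \<open>int_decode\<close> turns the sum into an ordinary series; the
  majorant \<open>M'\<close> makes the differentiated series uniformly convergent on the disc, while
  \<open>M\<close> gives convergence of the series itself.\<close>

lemma has_field_derivative_infsum_int:
  fixes f :: "int \<Rightarrow> complex \<Rightarrow> complex"
  assumes r: "r > 0"
    and d: "\<And>n x. x \<in> ball z r \<Longrightarrow> (f n has_field_derivative f' n x) (at x)"
    and b: "\<And>n x. x \<in> ball z r \<Longrightarrow> norm (f n x) \<le> M n"
    and b': "\<And>n x. x \<in> ball z r \<Longrightarrow> norm (f' n x) \<le> M' n"
    and M: "M summable_on UNIV" and M': "M' summable_on UNIV"
  shows "((\<lambda>x. \<Sum>\<^sub>\<infinity>n. f n x) has_field_derivative (\<Sum>\<^sub>\<infinity>n. f' n z)) (at z)"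
proof -
  let ?g = "\<lambda>k. f (int_decode k)" and ?g' = "\<lambda>k. f' (int_decode k)"
  have z: "z \<in> ball z r" using r by simp
  have U: "uniformly_convergent_on (ball z r) (\<lambda>n x. \<Sum>i<n. ?g' i x)"
    by (rule Weierstrass_m_test'[where M = "\<lambda>k. M' (int_decode k)"])
       (use b' summable_int_decode[OF M'] in auto)
  have sm: "(\<lambda>n. f n x) summable_on UNIV" if "x \<in> ball z r" for x
    by (rule summable_on_norm_bound[OF M]) (use b that in auto)
  have D: "((\<lambda>x. \<Sum>k. ?g k x) has_field_derivative (\<Sum>k. ?g' k z)) (at z)"
  proof (rule has_field_derivative_series'(2)[OF convex_ball _ U z])
    show "(?g n has_field_derivative ?g' n x) (at x within ball z r)" if "x \<in> ball z r" for n x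
      using d[OF that] by (rule has_field_derivative_at_within)
    show "summable (\<lambda>n. ?g n z)"
      using sums_infsum_int_decode[OF sm[OF z]] by (simp add: sums_iff)
  qed (use z in simp)
  have "(\<Sum>k. ?g' k z) = (\<Sum>\<^sub>\<infinity>n. f' n z)"
    using sums_infsum_int_decode[OF summable_on_norm_bound[OF M' b'[OF z]]] by (simp add: sums_iff)
  with D have "((\<lambda>x. \<Sum>k. ?g k x) has_field_derivative (\<Sum>\<^sub>\<infinity>n. f' n z)) (at z)" by simp
  thus ?thesis
  proof (rule has_field_derivative_transform_within_open[OF _ open_ball z])
    show "(\<Sum>k. ?g k x) = (\<Sum>\<^sub>\<infinity>n. f n x)" if "x \<in> ball z r" for x
      using sums_infsum_int_decode[OF sm[OF that]] by (simp add: sums_iff)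
  qed
qed

lemma summable_on_exp_abs_int: "(\<lambda>n::int. exp (- \<bar>of_int n - 1/2 :: real\<bar>)) summable_on UNIV"
proof -
  let ?f = "\<lambda>n::int. exp (- \<bar>of_int n - 1/2 :: real\<bar>)"
  \<comment> \<open>One geometric majorant exp(1 - k) serves both halves: the distance of n from 1/2
    is at least k - 1 for n = k as well as for n = -k - 1.\<close>
  have geo: "(\<lambda>k. exp 1 * exp (-1) ^ k :: real) summable_on (UNIV :: nat set)"
    by (rule norm_summable_imp_summable_on) (simp add: norm_mult norm_power summable_mult summable_geometric)
  have c: "g summable_on UNIV" if "\<And>k. 0 \<le> g k \<and> g k \<le> exp 1 * exp (-1) ^ k" for g :: "nat \<Rightarrow> real"
    by (rule summable_on_comparison_test[OF geo]) (use that in auto)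
  have e: "exp 1 * exp (-1) ^ k = exp (1 - real k)" for k :: nat
    by (simp add: exp_of_nat_mult[symmetric] exp_add[symmetric])
  have "(?f \<circ> int) summable_on UNIV"
    by (rule c) (auto simp: e)
  hence 1: "?f summable_on range int"
    by (subst summable_on_reindex) (auto simp: inj_on_def)
  have "(?f \<circ> (\<lambda>k. - int (Suc k))) summable_on UNIV"
    by (rule c) (auto simp: e)
  hence 2: "?f summable_on range (\<lambda>k. - int (Suc k))"
    by (subst summable_on_reindex) (auto simp: inj_on_def)
  have "?f summable_on (range int \<union> range (\<lambda>k. - int (Suc k)))"
    by (rule summable_on_Un_disjoint[OF 1 2]) auto
  moreover have "range int \<union> range (\<lambda>k. - int (Suc k)) = UNIV"
  proof -
    have "x \<in> range int \<union> range (\<lambda>k. - int (Suc k))" for x :: int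
      by (cases x) auto
    thus ?thesis by blast
  qed
  ultimately show ?thesis by simp
qed

section \<open>The theta series, its derivatives and its quasi-period\<close>

definition theta_term :: "nat \<Rightarrow> complex \<Rightarrow> complex \<Rightarrow> int \<Rightarrow> complex" where
  "theta_term j u t n = (-1) powi n * (of_int n - 1/2) ^ j *
     exp ((of_int n - 1/2)\<^sup>2 * t / 2 + (of_int n - 1/2) * u)"

text \<open>Up to the constant factor -i, \<open>theta 0 u t\<close> is Jacobi's theta_1(z) with u =
  2iz and nome exp(t/2). The exponential parametrisation avoids choosing branches of fractional
  powers of the nome.\<close>

definition theta :: "nat \<Rightarrow> complex \<Rightarrow> complex \<Rightarrow> complex" where
  "theta j u t = (\<Sum>\<^sub>\<infinity>n::int. theta_term j u t n)"

lemma power_le_fact_exp: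
  fixes x :: real
  assumes "x \<ge> 0"
  shows "x ^ j \<le> fact j * exp x"
proof -
  have "(\<Sum>k\<in>{j}. x ^ k /\<^sub>R fact k) \<le> (\<Sum>k. x ^ k /\<^sub>R fact k)"
    by (rule sum_le_suminf[OF summable_exp_generic]) (use assms in auto)
  hence "x ^ j / fact j \<le> exp x"
    by (simp add: exp_def field_simps)
  thus ?thesis by (simp add: field_simps)
qed

text \<open>The Gaussian factor beats everything else. The bound is uniform in u on a disc and in t
  on a half-plane, so it provides the majorants for differentiating in both variables at
  once.\<close>

lemma norm_theta_term_le:
  assumes c: "c > 0" "Re t \<le> -c" and K: "norm u \<le> K"
  shows "norm (theta_term j u t n) \<le>
           fact j * exp ((K + 2)\<^sup>2 / (2 * c)) * exp (- \<bar>of_int n - 1/2\<bar>)"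
proof -
  define x where "x = \<bar>of_int n - 1/2 :: real\<bar>"
  have x: "x \<ge> 0" by (simp add: x_def)
  have nn: "of_int n - 1/2 = complex_of_real (of_int n - 1/2)" by simp
  have nx: "norm (of_int n - 1/2 :: complex) = x"
    unfolding nn norm_of_real x_def by simp
  have "Re ((of_int n - 1/2)\<^sup>2 * t / 2) = x\<^sup>2 * Re t / 2"
    unfolding nn of_real_power[symmetric] x_def by simp
  also have "\<dots> \<le> x\<^sup>2 * (-c) / 2"
    by (intro divide_right_mono mult_left_mono c) auto
  finally have 1: "Re ((of_int n - 1/2)\<^sup>2 * t / 2) \<le> - c * x\<^sup>2 / 2" by (simp add: mult_ac)
  have "Re ((of_int n - 1/2) * u) \<le> norm ((of_int n - 1/2) * u)" by (rule complex_Re_le_cmod)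
  also have "\<dots> = x * norm u" by (simp add: norm_mult nx)
  also have "\<dots> \<le> x * K" by (intro mult_left_mono K x)
  finally have 2: "Re ((of_int n - 1/2) * u) \<le> x * K" .
  \<comment> \<open>Completing the square with K + 2: K pays for the factor in u, one unit for the
    power \<open>x ^ j\<close>, and one is left over as the summable factor exp(-x).\<close>
  have "0 \<le> (c * x - (K + 2))\<^sup>2" by simp
  hence "2 * c * ((K + 2) * x) - c\<^sup>2 * x\<^sup>2 \<le> (K + 2)\<^sup>2"
    by (simp add: power2_eq_square algebra_simps)
  hence 3: "(K + 2) * x - c * x\<^sup>2 / 2 \<le> (K + 2)\<^sup>2 / (2 * c)"
    using c by (simp add: field_simps power2_eq_square)
  have "norm (theta_term j u t n) =
      x ^ j * exp (Re ((of_int n - 1/2)\<^sup>2 * t / 2 + (of_int n - 1/2) * u))"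
    unfolding theta_term_def norm_mult norm_power norm_exp_eq_Re norm_power_int nx by simp
  also have "\<dots> \<le> (fact j * exp x) * exp (- c * x\<^sup>2 / 2 + x * K)"
    using 1 2 power_le_fact_exp[OF x, of j]
    by (intro mult_mono) (auto simp: x)
  also have "\<dots> = fact j * exp (((K + 2) * x - c * x\<^sup>2 / 2) + (-x))"
    by (simp add: exp_add[symmetric] algebra_simps)
  also have "\<dots> \<le> fact j * exp ((K + 2)\<^sup>2 / (2 * c) + (- x))"
    using 3 by simp
  finally show ?thesis unfolding exp_add x_def by (simp only: mult.assoc)
qed

lemma summable_on_theta_bound:
  "(\<lambda>n::int. C * exp (- \<bar>of_int n - 1/2 :: real\<bar>)) summable_on UNIV"
  by (intro summable_on_cmult_right summable_on_exp_abs_int)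

lemma abs_summable_theta_term:
  assumes "Re t < 0"
  shows "(\<lambda>n. norm (theta_term j u t n)) summable_on UNIV"
  by (rule Infinite_Sum.abs_summable_on_comparison_test'[OF summable_on_theta_bound norm_theta_term_le[where c = "- Re t" and K = "norm u"]])
     (use assms in \<open>auto intro: order_refl\<close>)

lemma summable_theta_term: "Re t < 0 \<Longrightarrow> theta_term j u t summable_on UNIV"
  using abs_summable_theta_term abs_summable_summable by blast

lemma has_sum_theta: "Re t < 0 \<Longrightarrow> (theta_term j u t has_sum theta j u t) UNIV"
  unfolding theta_def by (intro has_sum_infsum summable_theta_term)

text \<open>
  Since \<open>theta j\<close> is the \<open>j\<close>-th \<open>u\<close>-derivative of \<open>theta 0\<close>, the coefficient of \<open>\<beta>\<close> is the heat equation.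
\<close>

lemma has_field_derivative_theta:
  assumes t: "Re (t + \<beta> * x0) < 0"
  shows "((\<lambda>x. theta j (u + \<alpha> * x) (t + \<beta> * x)) has_field_derivative
           (\<alpha> * theta (Suc j) (u + \<alpha> * x0) (t + \<beta> * x0)
             + \<beta> / 2 * theta (Suc (Suc j)) (u + \<alpha> * x0) (t + \<beta> * x0))) (at x0)"
proof -
  define c where "c = - Re (t + \<beta> * x0) / 2"
  \<comment> \<open>On this disc \<open>\<beta> * x\<close> moves by at most c, which is half the
    distance of the base point from the imaginary axis; the added 1 covers \<beta> = 0.\<close>
  define r where "r = c / (norm \<beta> + 1)"
  define K where "K = norm (u + \<alpha> * x0) + norm \<alpha> * r"
  have c: "c > 0" using t by (simp add: c_def)
  have np: "norm \<beta> + 1 > 0" by (simp add: add_nonneg_pos)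
  have r: "r > 0" using c np by (simp add: r_def)
  define f where "f = (\<lambda>n x. theta_term j (u + \<alpha> * x) (t + \<beta> * x) n)"
  define f' where "f' = (\<lambda>n x. \<alpha> * theta_term (Suc j) (u + \<alpha> * x) (t + \<beta> * x) n
                      + \<beta> / 2 * theta_term (Suc (Suc j)) (u + \<alpha> * x) (t + \<beta> * x) n)"
  define B where "B = (\<lambda>j n. fact j * exp ((K + 2)\<^sup>2 / (2 * c)) * exp (- \<bar>of_int n - 1/2 :: real\<bar>))"
  have bd: "norm (theta_term i (u + \<alpha> * x) (t + \<beta> * x) n) \<le> B i n" if "x \<in> ball x0 r" for i x n
    unfolding B_def
  proof (rule norm_theta_term_le[OF c])
    have d: "norm (x - x0) \<le> r" using that by (simp add: dist_norm norm_minus_commute)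
    have "Re (\<beta> * (x - x0)) \<le> norm (\<beta> * (x - x0))" by (rule complex_Re_le_cmod)
    also have "\<dots> \<le> norm \<beta> * r" unfolding norm_mult by (intro mult_left_mono d) auto
    also have "\<dots> \<le> (norm \<beta> + 1) * r" using r by simp
    also have "\<dots> = c" using np by (simp add: r_def)
    finally have "Re (\<beta> * (x - x0)) \<le> c" .
    moreover have "Re (t + \<beta> * x) = Re (t + \<beta> * x0) + Re (\<beta> * (x - x0))"
      by (simp add: algebra_simps)
    moreover have "Re (t + \<beta> * x0) = - (2 * c)" unfolding c_def by (simp add: field_simps)
    ultimately show "Re (t + \<beta> * x) \<le> -c" by linarith
    have "u + \<alpha> * x = (u + \<alpha> * x0) + \<alpha> * (x - x0)" by (simp add: algebra_simps)
    hence "norm (u + \<alpha> * x) \<le> norm (u + \<alpha> * x0) + norm \<alpha> * norm (x - x0)"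
      by (metis norm_mult norm_triangle_ineq)
    also have "\<dots> \<le> K" unfolding K_def by (intro add_left_mono mult_left_mono d) auto
    finally show "norm (u + \<alpha> * x) \<le> K" .
  qed
  have "((\<lambda>x. \<Sum>\<^sub>\<infinity>n. f n x) has_field_derivative (\<Sum>\<^sub>\<infinity>n. f' n x0)) (at x0)"
  proof (rule has_field_derivative_infsum_int[OF r])
    show "(f n has_field_derivative f' n x) (at x)" for n x
      unfolding f_def f'_def theta_term_def
      by (rule derivative_eq_intros refl | simp)+ (simp add: field_simps power2_eq_square)
    show "norm (f n x) \<le> B j n" if "x \<in> ball x0 r" for n x
      unfolding f_def using bd that by auto
    show "norm (f' n x) \<le> norm \<alpha> * B (Suc j) n + norm (\<beta> / 2) * B (Suc (Suc j)) n"
      if "x \<in> ball x0 r" for n x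
      unfolding f'_def
      by (rule order_trans[OF norm_triangle_ineq], unfold norm_mult)
         (intro add_mono mult_left_mono bd that norm_ge_zero)
    show "B j summable_on UNIV" for j
      unfolding B_def by (rule summable_on_theta_bound)
    thus "(\<lambda>n. norm \<alpha> * B (Suc j) n + norm (\<beta> / 2) * B (Suc (Suc j)) n) summable_on UNIV"
      by (intro summable_on_add summable_on_cmult_right)
  qed
  moreover have "(\<Sum>\<^sub>\<infinity>n. f' n x0) = \<alpha> * theta (Suc j) (u + \<alpha> * x0) (t + \<beta> * x0)
             + \<beta> / 2 * theta (Suc (Suc j)) (u + \<alpha> * x0) (t + \<beta> * x0)"
    unfolding f'_def theta_def
    by (subst infsum_add) (simp_all only: infsum_cmult_right' summable_on_cmult_right summable_theta_term t)
  ultimately show ?thesis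
    unfolding f_def theta_def by simp
qed

text \<open>The reflection n -> 1 - n negates n - 1/2 and reverses the sign (-1)^n, so
  \<open>theta 0\<close> is odd and each differentiation changes the parity.\<close>

lemma theta_minus: "theta j (-u) t = (-1) ^ Suc j * theta j u t"
proof -
  have "theta j (-u) t = (\<Sum>\<^sub>\<infinity>n::int. theta_term j (-u) t (1 - n))"
    unfolding theta_def
    by (rule infsum_reindex_bij_betw[symmetric, of "\<lambda>n. 1 - n"])
       (auto intro!: bij_betwI[of _ _ _ "\<lambda>n. 1 - n"])
  also have "(\<lambda>n. theta_term j (-u) t (1 - n)) = (\<lambda>n. (-1) ^ Suc j * theta_term j u t n)"
  proof
    fix n :: int
    have 1: "of_int (1 - n) - 1/2 = -1 * (of_int n - 1/2 :: complex)" by simp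
    have 2: "(-1) powi (1 - n) = - ((-1) powi n :: complex)"
      by (cases "even n") (simp_all add: power_int_diff power_int_minus_left)
    have 3: "(-1 * (of_int n - 1/2)) * - u = (of_int n - 1/2) * u" by (simp add: algebra_simps)
    show "theta_term j (-u) t (1 - n) = (-1) ^ Suc j * theta_term j u t n"
      unfolding theta_term_def 1 2 3 power_mult_distrib by simp
  qed
  finally show ?thesis unfolding theta_def by (simp only: infsum_cmult_right')
qed

lemma theta_0_0 [simp]: "theta 0 0 t = 0"
  using theta_minus[of 0 0 t] by simp

text \<open>The shift n -> n - 1 absorbs the added t after completing the square. This is the
  quasi-period that reduces multiples of a torsion point.\<close>

lemma theta_period: "theta 0 (u + t) t = - exp (- t / 2 - u) * theta 0 u t"
proof -
  have "theta 0 (u + t) t = (\<Sum>\<^sub>\<infinity>n::int. theta_term 0 (u + t) t (n - 1))"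
    unfolding theta_def
    by (rule infsum_reindex_bij_betw[symmetric, of "\<lambda>n. n - 1"])
       (auto intro!: bij_betwI[of _ _ _ "\<lambda>n. n + 1"])
  also have "(\<lambda>n. theta_term 0 (u + t) t (n - 1)) = (\<lambda>n. - exp (- t / 2 - u) * theta_term 0 u t n)"
  proof
    fix n :: int
    have "(of_int (n - 1) - 1/2)\<^sup>2 * t / 2 + (of_int (n - 1) - 1/2) * (u + t)
        = (- t / 2 - u) + ((of_int n - 1/2)\<^sup>2 * t / 2 + (of_int n - 1/2) * u)"
      by (simp add: field_simps power2_eq_square)
    moreover have "(-1) powi (n - 1) = - ((-1) powi n :: complex)"
      by (simp add: power_int_diff)
    ultimately show "theta_term 0 (u + t) t (n - 1) = - exp (- t / 2 - u) * theta_term 0 u t n"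
      unfolding theta_term_def by (simp add: exp_add)
  qed
  finally show ?thesis unfolding theta_def by (simp only: infsum_cmult_right')
qed

section \<open>The addition theorem\<close>

lemma has_sum_mult_product:
  fixes f g :: "'a \<Rightarrow> complex"
  assumes f: "(f has_sum a) A" and g: "(g has_sum b) B"
    and f': "(\<lambda>x. norm (f x)) summable_on A" and g': "(\<lambda>x. norm (g x)) summable_on B"
  shows "((\<lambda>(x, y). f x * g y) has_sum (a * b)) (A \<times> B)"
proof (rule has_sum_SigmaI)
  show "((\<lambda>y. case (x, y) of (x, y) \<Rightarrow> f x * g y) has_sum f x * b) B" if "x \<in> A" for x
    using has_sum_cmult_right[OF g, of "f x"] by simp
  show "((\<lambda>x. f x * b) has_sum a * b) A"
    by (rule has_sum_cmult_left[OF f])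
  show "(\<lambda>(x, y). f x * g y) summable_on A \<times> B"
  proof (rule abs_summable_summable, subst Infinite_Sum.abs_summable_on_Sigma_iff, intro conjI ballI)
    show "(\<lambda>y. norm (case (x, y) of (x, y) \<Rightarrow> f x * g y)) summable_on B" for x
      using summable_on_cmult_right[OF g', of "norm (f x)"] by (simp add: norm_mult)
    have "(\<lambda>x. norm (f x) * (\<Sum>\<^sub>\<infinity>y\<in>B. norm (g y))) summable_on A"
      by (rule summable_on_cmult_left[OF f'])
    moreover have "(\<Sum>\<^sub>\<infinity>y\<in>B. norm (g y)) \<ge> 0" by (rule infsum_nonneg) simp
    ultimately show "(\<lambda>x. norm (\<Sum>\<^sub>\<infinity>y\<in>B. norm (case (x, y) of (x, y) \<Rightarrow> f x * g y))) summable_on A"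
      by (simp add: norm_mult infsum_cmult_right' abs_mult)
  qed
qed

text \<open>With u = iz, \<open>theta_odd\<close> and \<open>theta_even\<close> are Jacobi's theta_2
  and theta_3 at nome exp(t), the square of the nome of \<open>theta\<close>. The names refer to the
  parity of the doubled summation index, 2i + 1 or 2j.\<close>

definition theta_odd :: "complex \<Rightarrow> complex \<Rightarrow> complex" where
  "theta_odd u t = (\<Sum>\<^sub>\<infinity>i::int. exp ((of_int i + 1/2)\<^sup>2 * t + 2 * (of_int i + 1/2) * u))"

definition theta_even :: "complex \<Rightarrow> complex \<Rightarrow> complex" where
  "theta_even u t = (\<Sum>\<^sub>\<infinity>j::int. exp ((of_int j)\<^sup>2 * t + 2 * of_int j * u))"

lemma abs_summable_theta_odd:
  assumes t: "Re t < 0"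
  shows "(\<lambda>i::int. norm (exp ((of_int i + 1/2)\<^sup>2 * t + 2 * (of_int i + 1/2) * u))) summable_on UNIV"
proof -
  have "Re (2 * t) < 0" using t by simp
  hence "(\<lambda>i. norm (theta_term 0 (2 * u) (2 * t) i)) summable_on UNIV"
    by (rule abs_summable_theta_term)
  hence "(\<lambda>i. norm (theta_term 0 (2 * u) (2 * t) (i + 1))) summable_on UNIV"
    by (subst summable_on_reindex_bij_betw[of "\<lambda>i. i + 1"])
       (auto intro!: bij_betwI[of _ _ _ "\<lambda>i. i - 1"])
  moreover have "norm (theta_term 0 (2 * u) (2 * t) (i + 1)) =
      norm (exp ((of_int i + 1/2)\<^sup>2 * t + 2 * (of_int i + 1/2) * u))" for i
  proof -
    have "(of_int (i + 1) - 1/2)\<^sup>2 * (2 * t) / 2 + (of_int (i + 1) - 1/2) * (2 * u)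
        = (of_int i + 1/2)\<^sup>2 * t + 2 * (of_int i + 1/2) * u"
      by (simp add: field_simps)
    thus ?thesis unfolding theta_term_def by (simp add: norm_mult norm_power_int)
  qed
  ultimately show ?thesis by simp
qed

text \<open>Adding t to the argument \<open>2 * u\<close> moves the centre of the square from a
  half-integer to an integer, at the cost of the factor exp(t/4 + u).\<close>

lemma abs_summable_theta_even:
  assumes t: "Re t < 0"
  shows "(\<lambda>j::int. norm (exp ((of_int j)\<^sup>2 * t + 2 * of_int j * u))) summable_on UNIV"
proof -
  have "Re (2 * t) < 0" using t by simp
  hence "(\<lambda>j. norm (exp (t / 4 + u)) * norm (theta_term 0 (2 * u + t) (2 * t) j)) summable_on UNIV"
    by (intro summable_on_cmult_right abs_summable_theta_term)
  moreover have "norm (exp (t / 4 + u)) * norm (theta_term 0 (2 * u + t) (2 * t) j) =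
      norm (exp ((of_int j)\<^sup>2 * t + 2 * of_int j * u))" for j
  proof -
    have "(t / 4 + u) + ((of_int j - 1/2)\<^sup>2 * (2 * t) / 2 + (of_int j - 1/2) * (2 * u + t))
        = (of_int j)\<^sup>2 * t + 2 * of_int j * u"
      by (simp add: field_simps power2_eq_square)
    hence "exp (t / 4 + u) * exp ((of_int j - 1/2)\<^sup>2 * (2 * t) / 2 + (of_int j - 1/2) * (2 * u + t))
        = exp ((of_int j)\<^sup>2 * t + 2 * of_int j * u)"
      by (simp only: exp_add[symmetric])
    from arg_cong[OF this, of norm] show ?thesis
      unfolding theta_term_def by (simp only: norm_mult norm_power_int) simp
  qed
  ultimately show ?thesis by simp
qed

text \<open>In the double sum over (m, n) the exponent depends on m + n - 1 paired with u and on m -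
  n paired with v, and these separate. They have opposite parity: \<open>g1\<close> parametrises the
  pairs with m - n even, \<open>g2\<close> those with m - n odd, the latter with sign -1.\<close>

lemma theta_product:
  assumes t: "Re t < 0"
  shows "theta 0 (u + v) t * theta 0 (u - v) t =
           theta_odd u t * theta_even v t - theta_even u t * theta_odd v t"
proof -
  define f where "f = (\<lambda>(m, n). theta_term 0 (u + v) t m * theta_term 0 (u - v) t n)"
  define o' where "o' = (\<lambda>u i. exp ((of_int i + 1/2)\<^sup>2 * t + 2 * (of_int i + 1/2 :: complex) * u))"
  define e' where "e' = (\<lambda>u i. exp ((of_int i)\<^sup>2 * t + 2 * (of_int i :: complex) * u))"
  define g1 where "g1 = (\<lambda>(i::int, j::int). (i + j + 1, i - j + 1))"
  define g2 where "g2 = (\<lambda>(i::int, j::int). (i + j + 1, i - j))"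
  have o: "(o' u has_sum theta_odd u t) UNIV" "(\<lambda>i. norm (o' u i)) summable_on UNIV" for u
    using abs_summable_theta_odd[OF t, of u] has_sum_infsum[OF abs_summable_summable[OF abs_summable_theta_odd[OF t, of u]]]
    unfolding o'_def theta_odd_def by blast+
  have e: "(e' u has_sum theta_even u t) UNIV" "(\<lambda>i. norm (e' u i)) summable_on UNIV" for u
    using abs_summable_theta_even[OF t, of u] has_sum_infsum[OF abs_summable_summable[OF abs_summable_theta_even[OF t, of u]]]
    unfolding e'_def theta_even_def by blast+
  have F: "(f has_sum theta 0 (u + v) t * theta 0 (u - v) t) UNIV"
    using has_sum_mult_product[OF has_sum_theta has_sum_theta
        abs_summable_theta_term abs_summable_theta_term, OF t t t t]
    unfolding f_def by simp
  have f1: "f \<circ> g1 = (\<lambda>(i, j). o' u i * e' v j)"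
  proof (rule ext, clarify)
    fix i j :: int
    have "(-1) powi (i + j + 1) * (-1) powi (i - j + 1) = (1 :: complex)"
      by (cases "even i"; cases "even j") (simp_all add: power_int_minus_left)
    moreover have "((of_int (i + j + 1) - 1/2)\<^sup>2 * t / 2 + (of_int (i + j + 1) - 1/2) * (u + v))
        + ((of_int (i - j + 1) - 1/2)\<^sup>2 * t / 2 + (of_int (i - j + 1) - 1/2) * (u - v))
      = ((of_int i + 1/2)\<^sup>2 * t + 2 * (of_int i + 1/2) * u)
        + ((of_int j)\<^sup>2 * t + 2 * of_int j * v)"
      by (simp add: field_simps power2_eq_square)
    ultimately show "(f \<circ> g1) (i, j) = o' u i * e' v j"
      unfolding f_def g1_def o'_def e'_def theta_term_def
      by (simp only: comp_def prod.case exp_add[symmetric] power_0 mult_1_right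
          mult.assoc mult.left_commute[of "exp _"]) (simp only: mult.assoc[symmetric] exp_add[symmetric] mult_1_left)
  qed
  have f2: "f \<circ> g2 = (\<lambda>(i, j). - (e' u i * o' v j))"
  proof (rule ext, clarify)
    fix i j :: int
    have "(-1) powi (i + j + 1) * (-1) powi (i - j) = (-1 :: complex)"
      by (cases "even i"; cases "even j") (simp_all add: power_int_minus_left)
    moreover have "((of_int (i + j + 1) - 1/2)\<^sup>2 * t / 2 + (of_int (i + j + 1) - 1/2) * (u + v))
        + ((of_int (i - j) - 1/2)\<^sup>2 * t / 2 + (of_int (i - j) - 1/2) * (u - v))
      = ((of_int i)\<^sup>2 * t + 2 * of_int i * u)
        + ((of_int j + 1/2)\<^sup>2 * t + 2 * (of_int j + 1/2) * v)"
      by (simp add: field_simps power2_eq_square)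
    ultimately show "(f \<circ> g2) (i, j) = - (e' u i * o' v j)"
      unfolding f_def g2_def o'_def e'_def theta_term_def
      by (simp only: comp_def prod.case exp_add[symmetric] power_0 mult_1_right
          mult.assoc mult.left_commute[of "exp _"]) (simp only: mult.assoc[symmetric] exp_add[symmetric] mult_minus_left mult_1_left)
  qed
  have i1: "inj g1" and i2: "inj g2" by (auto simp: g1_def g2_def inj_on_def)
  have "((\<lambda>(i, j). o' u i * e' v j) has_sum theta_odd u t * theta_even v t) UNIV"
    using has_sum_mult_product[OF o(1) e(1) o(2) e(2)] by simp
  hence 1: "(f has_sum theta_odd u t * theta_even v t) (range g1)"
    unfolding has_sum_reindex[OF i1] f1 .
  have "((\<lambda>(i, j). e' u i * o' v j) has_sum theta_even u t * theta_odd v t) UNIV"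
    using has_sum_mult_product[OF e(1) o(1) e(2) o(2)] by simp
  hence "((\<lambda>x. - (case x of (i, j) \<Rightarrow> e' u i * o' v j)) has_sum - (theta_even u t * theta_odd v t)) UNIV"
    by (subst has_sum_uminus) simp
  hence 2: "(f has_sum - (theta_even u t * theta_odd v t)) (range g2)"
    unfolding has_sum_reindex[OF i2] f2 by (simp add: case_prod_unfold)
  have disj: "range g1 \<inter> range g2 = {}"
    by (auto simp: g1_def g2_def) presburger
  have un: "range g1 \<union> range g2 = UNIV"
  proof -
    have "(m, n) \<in> range g1 \<union> range g2" for m n
    proof (cases "even (m - n)")
      case True
      then obtain j where "m - n = 2 * j" by (elim evenE)
      hence "(m, n) = g1 (m - j - 1, j)" by (simp add: g1_def)
      thus ?thesis by blast
    next
      case False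
      then obtain j where "m - n = 2 * j + 1" by (elim oddE)
      hence "(m, n) = g2 (m - j - 1, j)" by (simp add: g2_def)
      thus ?thesis by blast
    qed
    thus ?thesis by auto
  qed
  have "(f has_sum theta_odd u t * theta_even v t + - (theta_even u t * theta_odd v t)) UNIV"
    using has_sum_Un_disjoint[OF 1 2 disj] unfolding un .
  from has_sum_unique[OF F this] show ?thesis by simp
qed

text \<open>By \<open>theta_product\<close> each product is a 2 x 2 determinant of vectors
  (\<open>theta_odd\<close>, \<open>theta_even\<close>), and the squares are determinants against
  the vector at 0. The identity is the Pluecker relation for the vectors at u, v, w, 0.\<close>

lemma theta_three_term:
  assumes t: "Re t < 0"
  shows "theta 0 (u + v) t * theta 0 (u - v) t * (theta 0 w t)\<^sup>2
       - theta 0 (u + w) t * theta 0 (u - w) t * (theta 0 v t)\<^sup>2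
       + theta 0 (v + w) t * theta 0 (v - w) t * (theta 0 u t)\<^sup>2 = 0"
proof -
  have sq: "(theta 0 x t)\<^sup>2 = theta_odd x t * theta_even 0 t - theta_even x t * theta_odd 0 t" for x
    using theta_product[OF t, of x 0] by (simp add: power2_eq_square)
  show ?thesis unfolding theta_product[OF t] sq by algebra
qed

text \<open>This is the coefficient of w^2 at w = 0 in \<open>theta_three_term\<close>; since
  \<open>theta 0\<close> vanishes at 0, its square contributes the square of
  \<open>theta 1 0 t\<close>.\<close>

lemma theta_wronskian:
  assumes t: "Re t < 0"
  shows "theta 0 (u + v) t * theta 0 (u - v) t * (theta 1 0 t)\<^sup>2
       = (theta 0 v t)\<^sup>2 * (theta 2 u t * theta 0 u t - (theta 1 u t)\<^sup>2)
       - (theta 0 u t)\<^sup>2 * (theta 2 v t * theta 0 v t - (theta 1 v t)\<^sup>2)"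
proof -
  let ?T = "\<lambda>j u. theta j u t"
  have d1: "((\<lambda>w. ?T j (u + w)) has_field_derivative ?T (Suc j) (u + w)) (at w)" for j u w
    using has_field_derivative_theta[of t 0 w j u 1] t by simp
  have d2: "((\<lambda>w. ?T j (u - w)) has_field_derivative - ?T (Suc j) (u - w)) (at w)" for j u w
    using has_field_derivative_theta[of t 0 w j u "-1"] t by simp
  have d3: "(?T j has_field_derivative ?T (Suc j) w) (at w)" for j w
    using d1[of j 0 w] by simp
  define F where "F = ?T 0 (u + v) * ?T 0 (u - v)"
  \<comment> \<open>As a function of w this vanishes identically, hence so do its derivative
    \<open>h'\<close> and the derivative of \<open>h'\<close> at 0, which is twice the wanted
    relation.\<close>
  define h where "h = (\<lambda>w. F * (?T 0 w)\<^sup>2 - ?T 0 (u + w) * ?T 0 (u - w) * (?T 0 v)\<^sup>2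
       + ?T 0 (v + w) * ?T 0 (v - w) * (?T 0 u)\<^sup>2)"
  define h' where "h' = (\<lambda>w. 2 * F * ?T 0 w * ?T 1 w
       - (?T 1 (u + w) * ?T 0 (u - w) - ?T 0 (u + w) * ?T 1 (u - w)) * (?T 0 v)\<^sup>2
       + (?T 1 (v + w) * ?T 0 (v - w) - ?T 0 (v + w) * ?T 1 (v - w)) * (?T 0 u)\<^sup>2)"
  have h0: "h = (\<lambda>w. 0)"
    unfolding h_def F_def using theta_three_term[OF t, of u v] by (intro ext) simp
  have "(h has_field_derivative h' w) (at w)" for w
    unfolding h_def h'_def
    by (rule derivative_eq_intros d1 d2 d3 refl)+ (simp add: algebra_simps)
  hence h'0: "h' = (\<lambda>w. 0)"
    unfolding h0 by (intro ext) (metis DERIV_const DERIV_unique)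
  have "(h' has_field_derivative (2 * F * (?T 1 0)\<^sup>2
       - 2 * (?T 2 u * ?T 0 u - (?T 1 u)\<^sup>2) * (?T 0 v)\<^sup>2
       + 2 * (?T 2 v * ?T 0 v - (?T 1 v)\<^sup>2) * (?T 0 u)\<^sup>2)) (at 0)"
    unfolding h'_def
    by (rule derivative_eq_intros d1 d2 d3 refl)+ (simp add: algebra_simps power2_eq_square numeral_2_eq_2)
  hence "2 * F * (?T 1 0)\<^sup>2
       - 2 * (?T 2 u * ?T 0 u - (?T 1 u)\<^sup>2) * (?T 0 v)\<^sup>2
       + 2 * (?T 2 v * ?T 0 v - (?T 1 v)\<^sup>2) * (?T 0 u)\<^sup>2 = 0"
    unfolding h'0 by (metis DERIV_const DERIV_unique)
  hence "F * (?T 1 0)\<^sup>2 = (?T 2 u * ?T 0 u - (?T 1 u)\<^sup>2) * (?T 0 v)\<^sup>2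
       - (?T 2 v * ?T 0 v - (?T 1 v)\<^sup>2) * (?T 0 u)\<^sup>2" by algebra
  thus ?thesis unfolding F_def by (simp only: mult_ac)
qed

section \<open>Logarithmic derivatives of theta\<close>

definition theta_quot :: "nat \<Rightarrow> complex \<Rightarrow> complex \<Rightarrow> complex" where
  "theta_quot j u t = theta j u t / theta 0 u t"

text \<open>
  \<open>dlog1\<close>, ..., \<open>dlog4\<close> are the \<open>u\<close>-derivatives of \<open>log (theta 0 u t)\<close>, written out so that they
  make sense without a branch of the logarithm.
\<close>

definition dlog1 :: "complex \<Rightarrow> complex \<Rightarrow> complex" where
  "dlog1 u t = theta_quot 1 u t"

definition dlog2 :: "complex \<Rightarrow> complex \<Rightarrow> complex" where
  "dlog2 u t = theta_quot 2 u t - (theta_quot 1 u t)\<^sup>2"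

definition dlog3 :: "complex \<Rightarrow> complex \<Rightarrow> complex" where
  "dlog3 u t = theta_quot 3 u t - 3 * theta_quot 1 u t * theta_quot 2 u t + 2 * theta_quot 1 u t ^ 3"

definition dlog4 :: "complex \<Rightarrow> complex \<Rightarrow> complex" where
  "dlog4 u t = theta_quot 4 u t - 4 * theta_quot 1 u t * theta_quot 3 u t - 3 * (theta_quot 2 u t)\<^sup>2
     + 12 * (theta_quot 1 u t)\<^sup>2 * theta_quot 2 u t - 6 * theta_quot 1 u t ^ 4"

text \<open>The factor 4 makes this E_2(exp t), see \<open>theta_null_ratio_eq_E2\<close>. One
  twelfth of it is the constant that must be added to \<open>- dlog2\<close> to obtain the
  Weierstrass function.\<close>

definition theta_null_ratio :: "complex \<Rightarrow> complex" where
  "theta_null_ratio t = 4 * theta 3 0 t / theta 1 0 t"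

lemma isCont_tendsto_nhds: "isCont f x \<Longrightarrow> (f \<longlongrightarrow> f x) (nhds x)"
  by (simp add: isCont_def tendsto_at_iff_tendsto_nhds)

text \<open>Derivatives are taken at x = 0 along a line with direction (\<alpha>, \<beta>) in the
  (u, t)-plane. The same statements then serve for u-derivatives, for t-derivatives and for the
  torsion lines u = ks, t = 5s.\<close>

lemma has_field_derivative_theta_at_0:
  assumes "Re t < 0"
  shows "((\<lambda>x. theta j (u + \<alpha> * x) (t + \<beta> * x)) has_field_derivative
           (\<alpha> * theta (Suc j) u t + \<beta> / 2 * theta (Suc (Suc j)) u t)) (at 0)"
  using has_field_derivative_theta[of t \<beta> 0 j u \<alpha>] assms by simp

lemma has_field_derivative_theta_0:
  assumes "Re t < 0" "theta 0 u t \<noteq> 0"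
  shows "((\<lambda>x. theta 0 (u + \<alpha> * x) (t + \<beta> * x)) has_field_derivative
           theta 0 u t * (\<alpha> * dlog1 u t + \<beta> / 2 * (dlog2 u t + (dlog1 u t)\<^sup>2))) (at 0)"
  by (rule DERIV_cong[OF has_field_derivative_theta_at_0[OF assms(1)]])
     (use assms(2) in \<open>simp add: dlog1_def dlog2_def theta_quot_def eval_nat_numeral field_simps\<close>)

lemma has_field_derivative_theta_quot:
  assumes "Re t < 0" "theta 0 u t \<noteq> 0"
  shows "((\<lambda>x. theta_quot j (u + \<alpha> * x) (t + \<beta> * x)) has_field_derivative
           (\<alpha> * (theta_quot (Suc j) u t - theta_quot j u t * theta_quot 1 u t)
            + \<beta> / 2 * (theta_quot (Suc (Suc j)) u t - theta_quot j u t * theta_quot 2 u t))) (at 0)"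
  unfolding theta_quot_def
  by (rule DERIV_cong, rule DERIV_divide[OF has_field_derivative_theta_at_0[OF assms(1)]
        has_field_derivative_theta_at_0[OF assms(1)]])
     (use assms(2) in simp, use assms(2) in \<open>simp add: eval_nat_numeral field_simps\<close>)

text \<open>For log theta the heat equation says that the t-derivative is (\<open>dlog2\<close> +
  \<open>dlog1\<close>^2)/2. The coefficient of \<beta> here is the u-derivative of that expression,
  and in \<open>has_field_derivative_dlog2\<close> it is the second one.\<close>

lemma has_field_derivative_dlog1:
  assumes "Re t < 0" "theta 0 u t \<noteq> 0"
  shows "((\<lambda>x. dlog1 (u + \<alpha> * x) (t + \<beta> * x)) has_field_derivative
           (\<alpha> * dlog2 u t + \<beta> * (dlog3 u t / 2 + dlog1 u t * dlog2 u t))) (at 0)"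
  unfolding dlog1_def
  by (rule DERIV_cong[OF has_field_derivative_theta_quot[OF assms]])
     (simp add: dlog2_def dlog3_def eval_nat_numeral field_simps)

lemma has_field_derivative_dlog2:
  assumes "Re t < 0" "theta 0 u t \<noteq> 0"
  shows "((\<lambda>x. dlog2 (u + \<alpha> * x) (t + \<beta> * x)) has_field_derivative
           (\<alpha> * dlog3 u t + \<beta> * (dlog4 u t / 2 + (dlog2 u t)\<^sup>2 + dlog1 u t * dlog3 u t))) (at 0)"
  unfolding dlog2_def
  by (rule derivative_eq_intros has_field_derivative_theta_quot assms refl)+
     (simp add: dlog1_def dlog3_def dlog4_def eval_nat_numeral field_simps)

lemma has_field_derivative_dlog3:
  assumes "Re t < 0" "theta 0 u t \<noteq> 0"
  shows "((\<lambda>x. dlog3 (u + \<alpha> * x) t) has_field_derivative \<alpha> * dlog4 u t) (at 0)"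
proof -
  note [derivative_intros] = has_field_derivative_theta_quot[OF assms, where \<beta> = 0, simplified]
  show ?thesis
    unfolding dlog3_def
    by (rule derivative_eq_intros refl)+
       (simp add: dlog4_def eval_nat_numeral field_simps)
qed

section \<open>Addition formulas at generic points\<close>

definition theta_good :: "complex \<Rightarrow> complex \<Rightarrow> complex \<Rightarrow> bool" where
  "theta_good u v t \<longleftrightarrow> Re t < 0 \<and> theta 0 u t \<noteq> 0 \<and> theta 0 v t \<noteq> 0 \<and>
     theta 0 (u + v) t \<noteq> 0 \<and> theta 0 (u - v) t \<noteq> 0 \<and> theta 1 0 t \<noteq> 0"

lemma theta_goodD:
  assumes "theta_good u v t"
  shows "Re t < 0" "theta 0 u t \<noteq> 0" "theta 0 v t \<noteq> 0" "theta 0 (u + v) t \<noteq> 0"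
    "theta 0 (u - v) t \<noteq> 0" "theta 1 0 t \<noteq> 0"
  using assms by (auto simp: theta_good_def)

text \<open>Genericity is an open condition. Hence an identity known at all generic points holds
  near each of them along any line and may be differentiated there.\<close>

lemma eventually_theta_good:
  assumes "theta_good u v t"
  shows "\<forall>\<^sub>F x in nhds 0. theta_good (u + \<alpha> * x) (v + \<gamma> * x) (t + \<beta> * x)"
proof -
  note g = theta_goodD[OF assms]
  have ev: "\<forall>\<^sub>F x in nhds 0. f x \<noteq> 0" if "(f has_field_derivative f') (at 0)" "f 0 \<noteq> 0"
    for f :: "complex \<Rightarrow> complex" and f'
    by (rule tendsto_imp_eventually_ne[OF isCont_tendsto_nhds[OF DERIV_isCont[OF that(1)]] that(2)])
  have th: "\<forall>\<^sub>F x in nhds 0. theta j (w + \<delta> * x) (t + \<beta> * x) \<noteq> 0" if "theta j w t \<noteq> 0" for j w \<delta>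
    by (rule ev[OF has_field_derivative_theta_at_0[OF g(1)]]) (use that in simp)
  have "isCont (\<lambda>x. Re (t + \<beta> * x)) 0" by (auto intro!: continuous_intros)
  hence r: "\<forall>\<^sub>F x in nhds 0. Re (t + \<beta> * x) < 0"
    by (rule order_tendstoD(2)[OF isCont_tendsto_nhds]) (use g(1) in simp)
  show ?thesis
    using r th[OF g(2), of \<alpha>] th[OF g(3), of \<gamma>] th[OF g(4), of "\<alpha> + \<gamma>"] th[OF g(5), of "\<alpha> - \<gamma>"] th[OF g(6), of 0]
    unfolding theta_good_def by eventually_elim (simp add: algebra_simps)
qed

text \<open>The theta form of the classical formula for sigma(u + v) sigma(u - v) as a difference of
  Weierstrass functions: the two Wronskians in \<open>theta_wronskian\<close> are theta^2 times
  \<open>dlog2\<close>.\<close>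

lemma theta_addition:
  assumes t: "Re t < 0" and u: "theta 0 u t \<noteq> 0" and v: "theta 0 v t \<noteq> 0"
  shows "theta 0 (u + v) t * theta 0 (u - v) t * (theta 1 0 t)\<^sup>2
       = (theta 0 u t)\<^sup>2 * (theta 0 v t)\<^sup>2 * (dlog2 u t - dlog2 v t)"
proof -
  have L: "theta 2 w t * theta 0 w t - (theta 1 w t)\<^sup>2 = (theta 0 w t)\<^sup>2 * dlog2 w t"
    if "theta 0 w t \<noteq> 0" for w
    using that by (simp add: dlog2_def theta_quot_def field_simps power2_eq_square)
  show ?thesis
    unfolding theta_wronskian[OF t, of u v] L[OF u] L[OF v] by algebra
qed

lemma dlog2_neq:
  assumes "theta_good u v t"
  shows "dlog2 u t - dlog2 v t \<noteq> 0"
  using theta_addition[OF theta_goodD(1-3)[OF assms]] theta_goodD[OF assms] by auto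

lemma DERIV_unique_eventually:
  assumes "(f has_field_derivative a) (at (0::complex))" "(g has_field_derivative b) (at 0)"
    and "\<forall>\<^sub>F x in nhds 0. f x = g x"
  shows "a = b"
proof -
  have "(g has_field_derivative a) (at 0)"
    using assms(1) DERIV_cong_ev[OF refl assms(3) refl] by blast
  thus ?thesis using assms(2) DERIV_unique by blast
qed

text \<open>The logarithmic derivative of \<open>theta_addition\<close> in an arbitrary direction:
  \<alpha> for u, \<gamma> for v, \<beta> for t. The denominator, the difference of the two
  \<open>dlog2\<close> values, is cleared. The three coordinate directions give three different
  addition formulas.\<close>

lemma log_deriv_addition:
  assumes good: "theta_good u v t"
  shows "(dlog2 u t - dlog2 v t) *
      ((\<alpha> + \<gamma>) * dlog1 (u + v) t + (\<alpha> - \<gamma>) * dlog1 (u - v) t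
       + \<beta> / 2 * (dlog2 (u + v) t + (dlog1 (u + v) t)\<^sup>2 + dlog2 (u - v) t + (dlog1 (u - v) t)\<^sup>2)
       + \<beta> * theta_null_ratio t / 4 - 2 * \<alpha> * dlog1 u t - 2 * \<gamma> * dlog1 v t
       - \<beta> * (dlog2 u t + (dlog1 u t)\<^sup>2 + dlog2 v t + (dlog1 v t)\<^sup>2))
     = \<alpha> * dlog3 u t - \<gamma> * dlog3 v t
       + \<beta> * (dlog4 u t / 2 + (dlog2 u t)\<^sup>2 + dlog1 u t * dlog3 u t - dlog4 v t / 2 - (dlog2 v t)\<^sup>2 - dlog1 v t * dlog3 v t)"
proof -
  note g = theta_goodD[OF good]
  note D0 = has_field_derivative_theta_0[OF g(1), where \<beta> = \<beta>]
  note DL = has_field_derivative_dlog2[OF g(1), where \<beta> = \<beta>]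
  have D1: "((\<lambda>x. theta 1 0 (t + \<beta> * x)) has_field_derivative theta 1 0 t * (\<beta> * theta_null_ratio t / 8)) (at 0)"
    using has_field_derivative_theta_at_0[OF g(1), of 1 0 0 \<beta>] g(6)
    by (simp add: theta_null_ratio_def eval_nat_numeral)
  define lhs where "lhs = (\<lambda>x. theta 0 ((u + v) + (\<alpha> + \<gamma>) * x) (t + \<beta> * x)
     * theta 0 ((u - v) + (\<alpha> - \<gamma>) * x) (t + \<beta> * x) * (theta 1 0 (t + \<beta> * x))\<^sup>2)"
  define rhs where "rhs = (\<lambda>x. (theta 0 (u + \<alpha> * x) (t + \<beta> * x))\<^sup>2 * (theta 0 (v + \<gamma> * x) (t + \<beta> * x))\<^sup>2
     * (dlog2 (u + \<alpha> * x) (t + \<beta> * x) - dlog2 (v + \<gamma> * x) (t + \<beta> * x)))"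
  \<comment> \<open>\<open>S1\<close> is the logarithmic derivative of the left side,
    \<open>S2\<close> that of the prefactor \<open>Q\<close> on the right, and \<open>D\<close> the
    derivative of the difference of the \<open>dlog2\<close> values.\<close>
  define S1 where "S1 = (\<alpha> + \<gamma>) * dlog1 (u + v) t + \<beta> / 2 * (dlog2 (u + v) t + (dlog1 (u + v) t)\<^sup>2)
     + ((\<alpha> - \<gamma>) * dlog1 (u - v) t + \<beta> / 2 * (dlog2 (u - v) t + (dlog1 (u - v) t)\<^sup>2)) + \<beta> * theta_null_ratio t / 4"
  define S2 where "S2 = 2 * (\<alpha> * dlog1 u t + \<beta> / 2 * (dlog2 u t + (dlog1 u t)\<^sup>2))
     + 2 * (\<gamma> * dlog1 v t + \<beta> / 2 * (dlog2 v t + (dlog1 v t)\<^sup>2))"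
  define D where "D = \<alpha> * dlog3 u t + \<beta> * (dlog4 u t / 2 + (dlog2 u t)\<^sup>2 + dlog1 u t * dlog3 u t)
     - (\<gamma> * dlog3 v t + \<beta> * (dlog4 v t / 2 + (dlog2 v t)\<^sup>2 + dlog1 v t * dlog3 v t))"
  define Q where "Q = (theta 0 u t)\<^sup>2 * (theta 0 v t)\<^sup>2"
  have l: "(lhs has_field_derivative
      (theta 0 (u + v) t * theta 0 (u - v) t * (theta 1 0 t)\<^sup>2) * S1) (at 0)"
    unfolding lhs_def S1_def
    by (rule derivative_eq_intros D0[OF g(4)] D0[OF g(5)] D1 refl)+
       (simp add: power2_eq_square algebra_simps)
  have r: "(rhs has_field_derivative Q * ((dlog2 u t - dlog2 v t) * S2 + D)) (at 0)"
    unfolding rhs_def S2_def D_def Q_def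
    by (rule derivative_eq_intros D0[OF g(2)] D0[OF g(3)] DL[OF g(2)] DL[OF g(3)] refl)+
       (simp add: power2_eq_square algebra_simps)
  have "\<forall>\<^sub>F x in nhds 0. lhs x = rhs x"
    using eventually_theta_good[OF good, of \<alpha> \<gamma> \<beta>]
  proof eventually_elim
    case (elim x)
    from theta_addition[OF theta_goodD(1-3)[OF this]] show ?case
      unfolding lhs_def rhs_def by (simp add: algebra_simps)
  qed
  from DERIV_unique_eventually[OF l r this]
  have "Q * ((dlog2 u t - dlog2 v t) * S1) = Q * ((dlog2 u t - dlog2 v t) * S2 + D)"
    unfolding theta_addition[OF g(1-3)] Q_def by (simp add: mult_ac)
  moreover have "Q \<noteq> 0" using g by (simp add: Q_def)
  ultimately have "(dlog2 u t - dlog2 v t) * S1 = (dlog2 u t - dlog2 v t) * S2 + D" by simp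
  hence "(dlog2 u t - dlog2 v t) * (S1 - S2) = D" by (simp add: algebra_simps)
  moreover have "S1 - S2 = (\<alpha> + \<gamma>) * dlog1 (u + v) t + (\<alpha> - \<gamma>) * dlog1 (u - v) t
       + \<beta> / 2 * (dlog2 (u + v) t + (dlog1 (u + v) t)\<^sup>2 + dlog2 (u - v) t + (dlog1 (u - v) t)\<^sup>2)
       + \<beta> * theta_null_ratio t / 4 - 2 * \<alpha> * dlog1 u t - 2 * \<gamma> * dlog1 v t
       - \<beta> * (dlog2 u t + (dlog1 u t)\<^sup>2 + dlog2 v t + (dlog1 v t)\<^sup>2)"
    unfolding S1_def S2_def by (simp add: algebra_simps)
  moreover have "D = \<alpha> * dlog3 u t - \<gamma> * dlog3 v t
       + \<beta> * (dlog4 u t / 2 + (dlog2 u t)\<^sup>2 + dlog1 u t * dlog3 u t - dlog4 v t / 2 - (dlog2 v t)\<^sup>2 - dlog1 v t * dlog3 v t)"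
    unfolding D_def by (simp add: algebra_simps)
  ultimately show ?thesis by simp
qed

text \<open>The u-direction of \<open>log_deriv_addition\<close>. In Weierstrass' notation the right
  side is wp'(u) / (wp(u) - wp(v)).\<close>

lemma dlog1_sum:
  assumes good: "theta_good u v t"
  shows "dlog1 (u + v) t + dlog1 (u - v) t - 2 * dlog1 u t = dlog3 u t / (dlog2 u t - dlog2 v t)"
  using log_deriv_addition[OF good, of 1 0 0] dlog2_neq[OF good] by (simp add: field_simps)

lemma dlog1_diff:
  assumes good: "theta_good u v t"
  shows "dlog1 (u + v) t - dlog1 (u - v) t - 2 * dlog1 v t = - dlog3 v t / (dlog2 u t - dlog2 v t)"
  using log_deriv_addition[OF good, of 0 1 0] dlog2_neq[OF good] by (simp add: field_simps)

text \<open>The u-derivative of \<open>dlog1_sum\<close>, both sides being equal near the generic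
  point.\<close>

lemma dlog2_sum_1:
  assumes good: "theta_good u v t"
  shows "dlog2 (u + v) t + dlog2 (u - v) t - 2 * dlog2 u t
    = dlog4 u t / (dlog2 u t - dlog2 v t) - (dlog3 u t / (dlog2 u t - dlog2 v t))\<^sup>2"
proof -
  note g = theta_goodD[OF good]
  note DZ = has_field_derivative_dlog1[OF g(1), where \<beta> = 0 and \<alpha> = 1, simplified]
  note DL = has_field_derivative_dlog2[OF g(1), where \<beta> = 0 and \<alpha> = 1, simplified]
  note DL1 = has_field_derivative_dlog3[OF g(1), where \<alpha> = 1, simplified]
  have 1: "((\<lambda>x. dlog1 ((u + v) + x) t + dlog1 ((u - v) + x) t - 2 * dlog1 (u + x) t) has_field_derivative
      dlog2 (u + v) t + dlog2 (u - v) t - 2 * dlog2 u t) (at 0)"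
    by (rule derivative_eq_intros DZ g refl)+ simp
  have 2: "((\<lambda>x. dlog3 (u + x) t / (dlog2 (u + x) t - dlog2 v t)) has_field_derivative
      dlog4 u t / (dlog2 u t - dlog2 v t) - (dlog3 u t / (dlog2 u t - dlog2 v t))\<^sup>2) (at 0)"
    by (rule DERIV_cong[OF DERIV_divide[OF DL1[OF g(2)] DERIV_diff[OF DL[OF g(2)] DERIV_const]]], use dlog2_neq[OF good] in simp)
       (use dlog2_neq[OF good] in \<open>simp add: power2_eq_square divide_simps\<close>)
  show ?thesis
  proof (rule DERIV_unique_eventually[OF 1 2])
    show "\<forall>\<^sub>F x in nhds 0. dlog1 ((u + v) + x) t + dlog1 ((u - v) + x) t - 2 * dlog1 (u + x) t
        = dlog3 (u + x) t / (dlog2 (u + x) t - dlog2 v t)"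
      using eventually_theta_good[OF good, of 1 0 0]
    proof eventually_elim
      case (elim x)
      from dlog1_sum[OF this] show ?case by (simp add: algebra_simps)
    qed
  qed
qed

text \<open>The v-derivative of \<open>dlog1_diff\<close>; moving v moves u - v backwards, which
  produces the sum on the left.\<close>

lemma dlog2_sum_2:
  assumes good: "theta_good u v t"
  shows "dlog2 (u + v) t + dlog2 (u - v) t - 2 * dlog2 v t
    = - dlog4 v t / (dlog2 u t - dlog2 v t) - (dlog3 v t / (dlog2 u t - dlog2 v t))\<^sup>2"
proof -
  note g = theta_goodD[OF good]
  note DZ = has_field_derivative_dlog1[OF g(1), where \<beta> = 0 and \<alpha> = 1, simplified]
  note DZ' = has_field_derivative_dlog1[OF g(1), where \<beta> = 0 and \<alpha> = "-1", simplified]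
  note DL = has_field_derivative_dlog2[OF g(1), where \<beta> = 0 and \<alpha> = 1, simplified]
  note DL1 = has_field_derivative_dlog3[OF g(1), where \<alpha> = 1, simplified]
  have 1: "((\<lambda>x. dlog1 ((u + v) + x) t - dlog1 ((u - v) - x) t - 2 * dlog1 (v + x) t) has_field_derivative
      dlog2 (u + v) t + dlog2 (u - v) t - 2 * dlog2 v t) (at 0)"
    by (rule derivative_eq_intros DZ DZ' g refl)+ simp
  have 2: "((\<lambda>x. - dlog3 (v + x) t / (dlog2 u t - dlog2 (v + x) t)) has_field_derivative
      - dlog4 v t / (dlog2 u t - dlog2 v t) - (dlog3 v t / (dlog2 u t - dlog2 v t))\<^sup>2) (at 0)"
    by (rule DERIV_cong[OF DERIV_divide[OF DERIV_minus[OF DL1[OF g(3)]] DERIV_diff[OF DERIV_const DL[OF g(3)]]]], use dlog2_neq[OF good] in simp)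
       (use dlog2_neq[OF good] in \<open>simp add: power2_eq_square divide_simps\<close>)
  show ?thesis
  proof (rule DERIV_unique_eventually[OF 1 2])
    show "\<forall>\<^sub>F x in nhds 0. dlog1 ((u + v) + x) t - dlog1 ((u - v) - x) t - 2 * dlog1 (v + x) t
        = - dlog3 (v + x) t / (dlog2 u t - dlog2 (v + x) t)"
      using eventually_theta_good[OF good, of 0 1 0]
    proof eventually_elim
      case (elim x)
      from dlog1_diff[OF this] show ?case by (simp add: algebra_simps)
    qed
  qed
qed

text \<open>The mixed relation: \<open>dlog1_sum\<close> differentiated in v, where only the
  denominator on the right moves.\<close>

lemma dlog2_diff:
  assumes good: "theta_good u v t"
  shows "dlog2 (u + v) t - dlog2 (u - v) t = dlog3 u t * dlog3 v t / (dlog2 u t - dlog2 v t)\<^sup>2"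
proof -
  note g = theta_goodD[OF good]
  note DZ = has_field_derivative_dlog1[OF g(1), where \<beta> = 0 and \<alpha> = 1, simplified]
  note DZ' = has_field_derivative_dlog1[OF g(1), where \<beta> = 0 and \<alpha> = "-1", simplified]
  note DL = has_field_derivative_dlog2[OF g(1), where \<beta> = 0 and \<alpha> = 1, simplified]
  have 1: "((\<lambda>x. dlog1 ((u + v) + x) t + dlog1 ((u - v) - x) t - 2 * dlog1 u t) has_field_derivative
      dlog2 (u + v) t - dlog2 (u - v) t) (at 0)"
    by (rule derivative_eq_intros DZ DZ' g refl)+ simp
  have 2: "((\<lambda>x. dlog3 u t / (dlog2 u t - dlog2 (v + x) t)) has_field_derivative
      dlog3 u t * dlog3 v t / (dlog2 u t - dlog2 v t)\<^sup>2) (at 0)"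
    by (rule DERIV_cong[OF DERIV_divide[OF DERIV_const DERIV_diff[OF DERIV_const DL[OF g(3)]]]],
        use dlog2_neq[OF good] in simp)
       (simp add: power2_eq_square)
  show ?thesis
  proof (rule DERIV_unique_eventually[OF 1 2])
    show "\<forall>\<^sub>F x in nhds 0. dlog1 ((u + v) + x) t + dlog1 ((u - v) - x) t - 2 * dlog1 u t
        = dlog3 u t / (dlog2 u t - dlog2 (v + x) t)"
      using eventually_theta_good[OF good, of 0 1 0]
    proof eventually_elim
      case (elim x)
      from dlog1_sum[OF this] show ?case by (simp add: algebra_simps)
    qed
  qed
qed

text \<open>The classical quadratic addition theorem: the square of zeta(u + v) - zeta(u) - zeta(v)
  is wp(u) + wp(v) + wp(u + v). The difference of the squares of \<open>M\<close> and
  \<open>N\<close> is \<open>dlog2_diff\<close>. Their sum comes from the t-derivative of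
  \<open>theta_addition\<close>, after the fourth derivatives are eliminated. The constant thus
  appears without any expansion at a pole.\<close>

lemma dlog1_addition:
  assumes good: "theta_good u v t"
  defines "M \<equiv> dlog1 (u + v) t - dlog1 u t - dlog1 v t" and "N \<equiv> dlog1 (u - v) t - dlog1 u t + dlog1 v t"
  shows "M\<^sup>2 = theta_null_ratio t / 4 - dlog2 u t - dlog2 v t - dlog2 (u + v) t"
    and "N\<^sup>2 = theta_null_ratio t / 4 - dlog2 u t - dlog2 v t - dlog2 (u - v) t"
proof -
  define d where "d = dlog2 u t - dlog2 v t"
  have d: "d \<noteq> 0" using dlog2_neq[OF good] by (simp add: d_def)
  \<comment> \<open>All relations become polynomial once the third and fourth derivatives are
    expressed through \<open>M\<close>, \<open>N\<close>, \<open>k\<close>, \<open>l\<close> and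
    \<open>d\<close>.\<close>
  define k l p where "k = dlog4 u t / (2 * d)" and "l = dlog4 v t / (2 * d)" and "p = theta_null_ratio t / 4"
  define a b where "a = dlog1 u t" and "b = dlog1 v t"
  have "M + N = dlog3 u t / d" "M - N = - dlog3 v t / d"
    using dlog1_sum[OF good] dlog1_diff[OF good] unfolding M_def N_def d_def by (simp_all add: algebra_simps)
  hence L1: "dlog3 u t = (M + N) * d" "dlog3 v t = - (M - N) * d"
    using d by (simp_all add: field_simps)
  have L2: "dlog4 u t = 2 * k * d" "dlog4 v t = 2 * l * d" using d by (simp_all add: k_def l_def)
  have Zp: "dlog1 (u + v) t = a + b + M" "dlog1 (u - v) t = a - b + N"
    by (simp_all add: M_def N_def a_def b_def)
  have e1: "dlog2 (u + v) t + dlog2 (u - v) t - 2 * dlog2 u t = 2 * k - (M + N)\<^sup>2"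
    using dlog2_sum_1[OF good] d unfolding d_def[symmetric] L1 L2 by simp
  have e2: "dlog2 (u + v) t + dlog2 (u - v) t - 2 * dlog2 v t = - 2 * l - (M - N)\<^sup>2"
    using dlog2_sum_2[OF good] d unfolding d_def[symmetric] L1 L2
    by (simp add: power2_commute)
  have "((M + N) * d) * (- (M - N) * d) / d\<^sup>2 = - (M + N) * (M - N)"
    using d by (simp add: field_simps power2_eq_square)
  hence e3: "dlog2 (u + v) t - dlog2 (u - v) t = - (M + N) * (M - N)"
    using dlog2_diff[OF good] unfolding d_def[symmetric] L1 L2 by simp
  \<comment> \<open>The t-direction, the only relation that involves
    \<open>theta_null_ratio\<close>; every term on its right has the factor
    \<open>d\<close>.\<close>
  have "2 * (d * (1 / 2 * (dlog2 (u + v) t + (a + b + M)\<^sup>2 + dlog2 (u - v) t + (a - b + N)\<^sup>2)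
       + p - (dlog2 u t + a\<^sup>2 + dlog2 v t + b\<^sup>2)))
     = 2 * (k * d + (dlog2 u t)\<^sup>2 + a * ((M + N) * d) - l * d - (dlog2 v t)\<^sup>2 - b * (- (M - N) * d))"
    using log_deriv_addition[OF good, of 0 0 1]
    unfolding d_def[symmetric] L1 L2 Zp a_def[symmetric] b_def[symmetric] p_def by simp
  also have "\<dots> = d * (2 * (k + (dlog2 u t + dlog2 v t) + a * (M + N) - l + b * (M - N)))"
    unfolding d_def by algebra
  also have "2 * (d * (1 / 2 * (dlog2 (u + v) t + (a + b + M)\<^sup>2 + dlog2 (u - v) t + (a - b + N)\<^sup>2)
       + p - (dlog2 u t + a\<^sup>2 + dlog2 v t + b\<^sup>2)))
     = d * (dlog2 (u + v) t + (a + b + M)\<^sup>2 + dlog2 (u - v) t + (a - b + N)\<^sup>2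
       + 2 * (p - (dlog2 u t + a\<^sup>2 + dlog2 v t + b\<^sup>2)))"
    by (simp add: algebra_simps)
  finally have e4: "dlog2 (u + v) t + (a + b + M)\<^sup>2 + dlog2 (u - v) t + (a - b + N)\<^sup>2
       + 2 * (p - (dlog2 u t + a\<^sup>2 + dlog2 v t + b\<^sup>2))
     = 2 * (k + (dlog2 u t + dlog2 v t) + a * (M + N) - l + b * (M - N))"
    using d by simp
  \<comment> \<open>\<open>e1\<close> and \<open>e2\<close> eliminate \<open>k\<close> and
    \<open>l\<close>, and all terms in \<open>a\<close> and \<open>b\<close> cancel.\<close>
  have e4': "M\<^sup>2 + N\<^sup>2 = 2 * p - 2 * dlog2 u t - 2 * dlog2 v t - dlog2 (u + v) t - dlog2 (u - v) t"
    using e1 e2 e4 by algebra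
  show "M\<^sup>2 = theta_null_ratio t / 4 - dlog2 u t - dlog2 v t - dlog2 (u + v) t"
    "N\<^sup>2 = theta_null_ratio t / 4 - dlog2 u t - dlog2 v t - dlog2 (u - v) t"
    using e3 e4' unfolding p_def[symmetric] by algebra+
qed

text \<open>The confluent case of \<open>theta_addition\<close>: with v = u fixed, the first
  argument moves away from u. Both sides vanish at the start, and their first derivatives give the
  analogue of sigma(2u) = - wp'(u) sigma(u)^4.\<close>

lemma dlog3_duplication:
  assumes t: "Re t < 0" and u: "theta 0 u t \<noteq> 0"
  shows "dlog3 u t * theta 0 u t ^ 4 = theta 0 (2 * u) t * theta 1 0 t ^ 3"
proof -
  note D0 = has_field_derivative_theta_at_0[OF t, where \<beta> = 0 and \<alpha> = 1, simplified]
  note DL = has_field_derivative_dlog2[OF t u, where \<beta> = 0 and \<alpha> = 1, simplified]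
  have l: "((\<lambda>x. theta 0 (2 * u + x) t * theta 0 (0 + x) t * (theta 1 0 t)\<^sup>2) has_field_derivative
      theta 0 (2 * u) t * theta 1 0 t ^ 3) (at 0)"
    by (rule derivative_eq_intros D0 refl)+ (simp add: power2_eq_square power3_eq_cube)
  have r: "((\<lambda>x. (theta 0 (u + x) t)\<^sup>2 * (theta 0 u t)\<^sup>2 * (dlog2 (u + x) t - dlog2 u t)) has_field_derivative
      dlog3 u t * theta 0 u t ^ 4) (at 0)"
    by (rule derivative_eq_intros D0 DL refl)+ (simp add: eval_nat_numeral)
  have "\<forall>\<^sub>F x in nhds 0. theta 0 (u + x) t \<noteq> 0"
    by (rule tendsto_imp_eventually_ne[OF isCont_tendsto_nhds[OF DERIV_isCont[OF D0[of 0 u]]]]) (use u in simp)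
  hence "\<forall>\<^sub>F x in nhds 0. theta 0 (2 * u + x) t * theta 0 (0 + x) t * (theta 1 0 t)\<^sup>2
      = (theta 0 (u + x) t)\<^sup>2 * (theta 0 u t)\<^sup>2 * (dlog2 (u + x) t - dlog2 u t)"
  proof eventually_elim
    case (elim x)
    have "u + x + u = 2 * u + x" "u + x - u = x" by simp_all
    thus ?case
      using theta_addition[OF t elim u] by simp
  qed
  from DERIV_unique_eventually[OF l r this] show ?thesis by simp
qed

section \<open>The triple product\<close>

text \<open>Tannery's theorem, transported to integer indices by \<open>int_decode\<close>.\<close>

lemma tendsto_infsum_int:
  fixes a :: "nat \<Rightarrow> int \<Rightarrow> complex"
  assumes lim: "\<And>n. (\<lambda>N. a N n) \<longlonglongrightarrow> b n"
    and bound: "\<And>N n. norm (a N n) \<le> M n" and M: "M summable_on UNIV"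
  shows "(\<lambda>N. \<Sum>\<^sub>\<infinity>n. a N n) \<longlonglongrightarrow> (\<Sum>\<^sub>\<infinity>n. b n)"
proof -
  have b: "norm (b n) \<le> M n" for n
    by (rule Lim_norm_ubound[OF _ lim]) (use bound in auto)
  have "eventually (\<lambda>(k, N). norm (a N (int_decode k)) \<le> M (int_decode k)) (at_top \<times>\<^sub>F sequentially)"
    using bound by (intro always_eventually) auto
  from tannerys_theorem[where a = "\<lambda>k N. a N (int_decode k)" and b = "\<lambda>k. b (int_decode k)", OF lim this summable_int_decode[OF M]]
  have "(\<lambda>N. \<Sum>k. a N (int_decode k)) \<longlonglongrightarrow> (\<Sum>k. b (int_decode k))" by simp
  moreover have "(\<Sum>k. a N (int_decode k)) = (\<Sum>\<^sub>\<infinity>n. a N n)" for N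
    using sums_infsum_int_decode[OF summable_on_norm_bound[OF M bound[of N]]] by (simp add: sums_iff)
  moreover have "(\<Sum>k. b (int_decode k)) = (\<Sum>\<^sub>\<infinity>n. b n)"
    using sums_infsum_int_decode[OF summable_on_norm_bound[OF M b]] by (simp add: sums_iff)
  ultimately show ?thesis by simp
qed

section \<open>Gaussian binomials and the finite triple product\<close>

fun q_binom :: "complex \<Rightarrow> nat \<Rightarrow> nat \<Rightarrow> complex" where
  "q_binom p n 0 = 1"
| "q_binom p 0 (Suc k) = 0"
| "q_binom p (Suc n) (Suc k) = p ^ Suc k * q_binom p n (Suc k) + q_binom p n k"

definition q_fact :: "nat \<Rightarrow> complex \<Rightarrow> complex" where
  "q_fact n p = (\<Prod>k<n. 1 - p ^ Suc k)"

lemma q_fact_0 [simp]: "q_fact 0 p = 1" by (simp add: q_fact_def)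

lemma q_fact_Suc: "q_fact (Suc n) p = q_fact n p * (1 - p ^ Suc n)" by (simp add: q_fact_def)

lemma q_binom_eq_0: "k > n \<Longrightarrow> q_binom p n k = 0"
  by (induction p n k rule: q_binom.induct) auto

lemma q_binom_self: "q_binom p n n = 1"
  by (induction n) (simp_all add: q_binom_eq_0)

text \<open>The q-Pascal rule defines \<open>q_binom\<close> without division, so the quotient
  formula is stated as a product. The induction step rests on 1 - p^(k+m) = p^k (1 - p^m) + (1 -
  p^k).\<close>

lemma q_binom_mult_q_fact: "q_binom p (k + m) k * q_fact k p * q_fact m p = q_fact (k + m) p"
proof (induction "k + m" arbitrary: k m)
  case (Suc n)
  show ?case
  proof (cases k)
    case k: (Suc k')
    show ?thesis
    proof (cases m)
      case 0
      thus ?thesis by (simp add: q_binom_self)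
    next
      case m: (Suc m')
      have 1: "q_binom p (k + m') k * q_fact k p * q_fact m' p = q_fact (k + m') p"
        and 2: "q_binom p (k' + m) k' * q_fact k' p * q_fact m p = q_fact (k' + m) p"
        by (rule Suc(1), use Suc(2) k m in simp)+
      have e: "k + m' = k' + m" using k m by simp
      have "q_binom p (k + m) k = p ^ k * q_binom p (k + m') k + q_binom p (k' + m) k'"
        using k m by simp
      hence "q_binom p (k + m) k * q_fact k p * q_fact m p
          = p ^ k * (q_binom p (k + m') k * q_fact k p * q_fact m' p) * (1 - p ^ m)
            + (q_binom p (k' + m) k' * q_fact k' p * q_fact m p) * (1 - p ^ k)"
        using k m by (simp add: q_fact_Suc algebra_simps)
      also have "\<dots> = q_fact (k' + m) p * (1 - p ^ (k + m))"
        unfolding 1 2 unfolding e by (simp add: algebra_simps power_add)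
      also have "\<dots> = q_fact (k + m) p" using k by (simp add: q_fact_Suc)
      finally show ?thesis .
    qed
  qed simp
qed simp

text \<open>Splitting off the factor with k = 0 leaves the same product for u + t, whose extra
  powers of exp t are exactly the weights in the q-Pascal rule; hence u must vary in the
  induction.\<close>

lemma q_binomial_theorem:
  "(\<Prod>k<N. 1 - exp (u + of_nat k * t)) =
   (\<Sum>j\<le>N. (-1) ^ j * exp (of_nat j * (of_nat j - 1) / 2 * t + of_nat j * u) * q_binom (exp t) N j)"
proof (induction N arbitrary: u)
  case (Suc N)
  define c where "c = (\<lambda>j::nat. (-1) ^ j * exp (of_nat j * (of_nat j - 1) / 2 * t + of_nat j * u))"
  define G where "G = q_binom (exp t)"
  have c_Suc: "c (Suc j) = - exp u * exp t ^ j * c j" for j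
  proof -
    have "of_nat (Suc j) * (of_nat (Suc j) - 1) / 2 * t + of_nat (Suc j) * u
        = (u + of_nat j * t) + (of_nat j * (of_nat j - 1) / 2 * t + of_nat j * u)"
      by (simp add: field_simps)
    thus ?thesis unfolding c_def by (simp add: exp_add exp_of_nat_mult)
  qed
  have sh: "(-1) ^ j * exp (of_nat j * (of_nat j - 1) / 2 * t + of_nat j * (u + t)) = c j * exp t ^ j" for j
    unfolding c_def by (simp add: exp_add exp_of_nat_mult distrib_left)
  have "(\<Prod>k<Suc N. 1 - exp (u + of_nat k * t)) = (1 - exp u) * (\<Prod>k<N. 1 - exp ((u + t) + of_nat k * t))"
    by (simp add: prod.lessThan_Suc_shift algebra_simps del: prod.lessThan_Suc)
  also have "\<dots> = (1 - exp u) * (\<Sum>j\<le>N. c j * exp t ^ j * G N j)"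
    unfolding Suc.IH sh G_def ..
  also have "\<dots> = (\<Sum>j\<le>N. c j * exp t ^ j * G N j) + (\<Sum>j\<le>N. c (Suc j) * G N j)"
    unfolding c_Suc by (simp add: left_diff_distrib sum_distrib_left sum_subtractf algebra_simps sum_negf)
  also have "(\<Sum>j\<le>N. c j * exp t ^ j * G N j) = (\<Sum>j\<le>Suc N. c j * exp t ^ j * G N j)"
    by (simp add: G_def q_binom_eq_0)
  also have "\<dots> = 1 + (\<Sum>j\<le>N. c (Suc j) * exp t ^ Suc j * G N (Suc j))"
    unfolding sum.atMost_Suc_shift by (simp add: c_def G_def)
  also have "1 + (\<Sum>j\<le>N. c (Suc j) * exp t ^ Suc j * G N (Suc j)) + (\<Sum>j\<le>N. c (Suc j) * G N j)
      = 1 + (\<Sum>j\<le>N. c (Suc j) * G (Suc N) (Suc j))"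
    by (simp add: G_def sum.distrib[symmetric] algebra_simps)
  also have "\<dots> = (\<Sum>j\<le>Suc N. c j * G (Suc N) j)"
    unfolding sum.atMost_Suc_shift by (simp add: c_def G_def)
  finally show ?case unfolding c_def G_def .
qed simp

lemma prod_lessThan_add:
  fixes f :: "nat \<Rightarrow> complex"
  shows "(\<Prod>k<m + n. f k) = (\<Prod>k<m. f k) * (\<Prod>k<n. f (m + k))"
  by (induction n) (simp_all add: mult_ac)

text \<open>The q-binomial theorem with 2n factors started at u - nt and summation index recentred
  as j = n + i.\<close>

lemma finite_triple_product:
  "(\<Prod>k<n. 1 - exp (of_nat (Suc k) * t - u)) * (\<Prod>k<n. 1 - exp (u + of_nat k * t)) =
   (\<Sum>i = - int n..int n. (-1) powi i * exp (of_int i * (of_int i - 1) / 2 * t + of_int i * u)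
      * q_binom (exp t) (2 * n) (nat (int n + i)))"
proof -
  \<comment> \<open>The product of the n monomials - exp(u - (k+1)t) by which the factors 1 -
    exp((k+1)t - u) become 1 - exp(u - (k+1)t); the same \<open>C n\<close> comes out of the
    recentred sum.\<close>
  define C where "C = (\<lambda>n. (-1) ^ n * exp (of_nat n * u - of_nat n * (of_nat n + 1) / 2 * t))"
  have C: "(\<Prod>k<n. - exp (u - of_nat (Suc k) * t)) = C n" for n
  proof (induction n)
    case (Suc n)
    have "(of_nat n * u - of_nat n * (of_nat n + 1) / 2 * t) + (u - of_nat (Suc n) * t)
        = of_nat (Suc n) * u - of_nat (Suc n) * (of_nat (Suc n) + 1) / 2 * t"
      by (simp add: field_simps)
    hence "exp (of_nat n * u - of_nat n * (of_nat n + 1) / 2 * t) * exp (u - of_nat (Suc n) * t)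
        = exp (of_nat (Suc n) * u - of_nat (Suc n) * (of_nat (Suc n) + 1) / 2 * t)"
      by (simp only: exp_add[symmetric])
    thus ?case using Suc by (simp add: C_def del: of_nat_Suc)
  qed (simp add: C_def)
  have C0: "C n \<noteq> 0" for n by (simp add: C_def)
  have "C n * ((\<Prod>k<n. 1 - exp (of_nat (Suc k) * t - u)) * (\<Prod>k<n. 1 - exp (u + of_nat k * t)))
      = (\<Prod>k<n. 1 - exp (u - of_nat (Suc k) * t)) * (\<Prod>k<n. 1 - exp (u + of_nat k * t))"
  proof -
    have "- exp (u - a) * (1 - exp (a - u)) = 1 - exp (u - a)" for a :: complex
      by (simp add: algebra_simps exp_add[symmetric])
    thus ?thesis
      unfolding C[symmetric] mult.assoc[symmetric] prod.distrib[symmetric] by simp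
  qed
  also have "(\<Prod>k<n. 1 - exp (u - of_nat (Suc k) * t)) * (\<Prod>k<n. 1 - exp (u + of_nat k * t))
      = (\<Prod>k<n. 1 - exp ((u - of_nat n * t) + of_nat k * t)) * (\<Prod>k<n. 1 - exp ((u - of_nat n * t) + of_nat (n + k) * t))"
  proof (rule arg_cong2[where f = times])
    show "(\<Prod>k<n. 1 - exp (u - of_nat (Suc k) * t)) = (\<Prod>k<n. 1 - exp ((u - of_nat n * t) + of_nat k * t))"
      by (subst prod.nat_diff_reindex[symmetric], rule prod.cong) (auto simp: of_nat_diff algebra_simps)
    show "(\<Prod>k<n. 1 - exp (u + of_nat k * t)) = (\<Prod>k<n. 1 - exp ((u - of_nat n * t) + of_nat (n + k) * t))"
      by (simp add: algebra_simps)
  qed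
  also have "\<dots> = (\<Prod>k<n + n. 1 - exp ((u - of_nat n * t) + of_nat k * t))"
    by (rule prod_lessThan_add[symmetric])
  also have "\<dots> = (\<Sum>j\<le>n + n. (-1) ^ j * exp (of_nat j * (of_nat j - 1) / 2 * t + of_nat j * (u - of_nat n * t))
      * q_binom (exp t) (n + n) j)"
    by (rule q_binomial_theorem)
  also have "\<dots> = (\<Sum>i = - int n..int n. C n * ((-1) powi i * exp (of_int i * (of_int i - 1) / 2 * t + of_int i * u)
      * q_binom (exp t) (2 * n) (nat (int n + i))))"
  proof (rule sum.reindex_bij_witness[of _ "\<lambda>i. nat (int n + i)" "\<lambda>j. int j - int n"])
    fix j assume "j \<in> {..n + n}"
    define i where "i = int j - int n"
    have j: "int j = int n + i" by (simp add: i_def)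
    have cj: "of_nat j = (of_nat n + of_int i :: complex)"
      using arg_cong[OF j, of "of_int :: int \<Rightarrow> complex"] by simp
    have "(-1) ^ j = ((-1) powi (int n + i) :: complex)" unfolding j[symmetric] by simp
    also have "\<dots> = (-1) ^ n * (-1) powi i" by (simp add: power_int_add)
    finally have s: "(-1) ^ j = ((-1) ^ n * (-1) powi i :: complex)" .
    have "of_nat j * (of_nat j - 1) / 2 * t + of_nat j * (u - of_nat n * t)
        = (of_nat n * u - of_nat n * (of_nat n + 1) / 2 * t)
          + (of_int i * (of_int i - 1) / 2 * t + of_int i * u)"
      unfolding cj by (simp add: field_simps)
    thus "C n * ((-1) powi (int j - int n) * exp (of_int (int j - int n) * (of_int (int j - int n) - 1) / 2 * t
           + of_int (int j - int n) * u) * q_binom (exp t) (2 * n) (nat (int n + (int j - int n))))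
        = (-1) ^ j * exp (of_nat j * (of_nat j - 1) / 2 * t + of_nat j * (u - of_nat n * t))
           * q_binom (exp t) (n + n) j"
      unfolding i_def[symmetric] s C_def j[symmetric] by (simp add: exp_add mult_2)
  qed auto
  finally show ?thesis unfolding sum_distrib_left[symmetric] using C0[of n] by simp
qed

lemma norm_exp_less_1: "Re t < 0 \<Longrightarrow> norm (exp t :: complex) < 1" by simp

lemma q_fact_eq_exp:
  assumes "norm p < 1"
  shows "q_fact n p = exp (\<Sum>k<n. Ln (1 - p ^ Suc k))"
  unfolding exp_sum[OF finite_lessThan] q_fact_def
  by (rule prod.cong) (use one_minus_in_slit(2)[OF assms] in \<open>simp_all del: power_Suc\<close>)

lemma q_fact_nonzero: "norm p < 1 \<Longrightarrow> q_fact n p \<noteq> 0"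
  by (simp add: q_fact_eq_exp)

lemma q_fact_tendsto:
  assumes "norm p < 1"
  shows "(\<lambda>n. q_fact n p) \<longlonglongrightarrow> qq_powr 1 p"
  unfolding q_fact_eq_exp[OF assms] qq_powr_def
  using summable_LIMSEQ[OF summable_log[OF assms]] by (auto intro!: tendsto_intros)

lemma qq_powr_nonzero [simp]: "qq_powr c p \<noteq> 0"
  by (simp add: qq_powr_def)

lemma central_q_binom_eq:
  assumes "norm p < 1" "\<bar>i\<bar> \<le> int n"
  shows "q_binom p (2 * n) (nat (int n + i)) = q_fact (2 * n) p / (q_fact (nat (int n + i)) p * q_fact (nat (int n - i)) p)"
proof -
  have "nat (int n + i) + nat (int n - i) = 2 * n" using assms(2) by auto
  thus ?thesis
    using q_binom_mult_q_fact[of p "nat (int n + i)" "nat (int n - i)"]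
      q_fact_nonzero[OF assms(1)] by (simp add: field_simps)
qed

text \<open>The domination needed for passing to the limit: \<open>q_fact\<close> converges to a
  nonzero value, so both it and its inverse are bounded.\<close>

lemma central_q_binom_bounded:
  assumes p: "norm p < 1"
  obtains B where "B > 0" "\<And>n i. \<bar>i\<bar> \<le> int n \<Longrightarrow> norm (q_binom p (2 * n) (nat (int n + i))) \<le> B"
proof -
  have lim: "(\<lambda>n. q_fact n p) \<longlonglongrightarrow> qq_powr 1 p" by (rule q_fact_tendsto[OF p])
  obtain K where K: "K > 0" "\<And>n. norm (q_fact n p) \<le> K"
    using convergent_imp_Bseq[OF convergentI[OF lim]] by (auto simp: Bseq_def)
  obtain K' where K': "K' > 0" "\<And>n. norm (inverse (q_fact n p)) \<le> K'"
    using convergent_imp_Bseq[OF convergentI[OF tendsto_inverse[OF lim]]] by (auto simp: Bseq_def)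
  show ?thesis
  proof (rule that[of "K * (K' * K')"])
    show "norm (q_binom p (2 * n) (nat (int n + i))) \<le> K * (K' * K')" if "\<bar>i\<bar> \<le> int n" for n i
    proof -
      have "q_binom p (2 * n) (nat (int n + i)) = q_fact (2 * n) p *
          (inverse (q_fact (nat (int n + i)) p) * inverse (q_fact (nat (int n - i)) p))"
        unfolding central_q_binom_eq[OF p that] by (simp add: field_simps)
      thus ?thesis
        unfolding norm_mult using K K' by (auto simp: norm_mult intro!: mult_mono simp del: norm_inverse)
    qed
  qed (use K K' in auto)
qed

text \<open>For fixed i the coefficient tends to 1/(p;p), because its three q-factorials have the
  common limit (p;p); the uniform bound permits taking the limit under the sum.\<close>

lemma tendsto_sum_central_q_binom:
  assumes p: "norm p < 1" and c: "(\<lambda>i::int. norm (c i :: complex)) summable_on UNIV"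
  shows "(\<lambda>n. \<Sum>i = - int n..int n. c i * q_binom p (2 * n) (nat (int n + i))) \<longlonglongrightarrow> infsum c UNIV / qq_powr 1 p"
proof -
  obtain B where B: "B > 0" "\<And>n i. \<bar>i\<bar> \<le> int n \<Longrightarrow> norm (q_binom p (2 * n) (nat (int n + i))) \<le> B"
    using central_q_binom_bounded[OF p] by blast
  \<comment> \<open>Extension by zero puts all the finite sums over the same index set.\<close>
  define a where "a = (\<lambda>n i. if \<bar>i\<bar> \<le> int n then c i * q_binom p (2 * n) (nat (int n + i)) else 0)"
  have fin: "(\<Sum>i = - int n..int n. c i * q_binom p (2 * n) (nat (int n + i))) = infsum (a n) UNIV" for n
  proof -
    have "infsum (a n) UNIV = infsum (a n) {- int n..int n}"
      by (rule infsum_cong_neutral) (auto simp: a_def)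
    also have "\<dots> = (\<Sum>i = - int n..int n. a n i)" by (rule infsum_finite) simp
    also have "\<dots> = (\<Sum>i = - int n..int n. c i * q_binom p (2 * n) (nat (int n + i)))"
      by (rule sum.cong) (auto simp: a_def)
    finally show ?thesis ..
  qed
  have "(\<lambda>n. infsum (a n) UNIV) \<longlonglongrightarrow> (\<Sum>\<^sub>\<infinity>i. c i * inverse (qq_powr 1 p))"
  proof (rule tendsto_infsum_int[where M = "\<lambda>i. B * norm (c i)"])
    show "norm (a n i) \<le> B * norm (c i)" for n i
      using B by (auto simp: a_def norm_mult mult.commute[of B] intro!: mult_left_mono)
    show "(\<lambda>i. B * norm (c i)) summable_on UNIV" by (intro summable_on_cmult_right c)
    show "(\<lambda>n. a n i) \<longlonglongrightarrow> c i * inverse (qq_powr 1 p)" for i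
    proof -
      have s: "filterlim (\<lambda>n. nat (int n + j)) at_top sequentially" for j
        unfolding filterlim_at_top
      proof
        show "\<forall>\<^sub>F n in sequentially. Z \<le> nat (int n + j)" for Z
          using eventually_ge_at_top[of "Z + nat \<bar>j\<bar>"] by eventually_elim auto
      qed
      have s2: "filterlim (\<lambda>n::nat. 2 * n) at_top sequentially"
        by (rule filterlim_subseq) (simp add: strict_mono_def)
      note L = filterlim_compose[OF q_fact_tendsto[OF p]]
      have "(\<lambda>n. c i * (q_fact (2 * n) p / (q_fact (nat (int n + i)) p * q_fact (nat (int n + - i)) p)))
          \<longlonglongrightarrow> c i * (qq_powr 1 p / (qq_powr 1 p * qq_powr 1 p))"
        by (intro tendsto_intros L[OF s] L[OF s2]) simp
      moreover have "\<forall>\<^sub>F n in sequentially. c i * (q_fact (2 * n) p / (q_fact (nat (int n + i)) p * q_fact (nat (int n + - i)) p)) = a n i"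
        using eventually_ge_at_top[of "nat \<bar>i\<bar>"]
        by eventually_elim (simp add: a_def central_q_binom_eq[OF p])
      ultimately have "(\<lambda>n. a n i) \<longlonglongrightarrow> c i * (qq_powr 1 p / (qq_powr 1 p * qq_powr 1 p))"
        by (rule Lim_transform_eventually)
      thus ?thesis by (simp add: field_simps)
    qed
  qed
  thus ?thesis unfolding fin by (simp add: infsum_cmult_left' divide_inverse)
qed

lemma theta_term_0_eq:
  "exp (- t / 8 + u / 2) * theta_term 0 u t i
     = (-1) powi i * exp (of_int i * (of_int i - 1) / 2 * t + of_int i * u)"
proof -
  have "(- t / 8 + u / 2) + ((of_int i - 1/2)\<^sup>2 * t / 2 + (of_int i - 1/2) * u)
      = of_int i * (of_int i - 1) / 2 * t + of_int i * u"
    by (simp add: field_simps power2_eq_square)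
  thus ?thesis unfolding theta_term_def by (simp add: exp_add[symmetric] mult.left_commute)
qed

lemma infsum_theta_0:
  "(\<Sum>\<^sub>\<infinity>i::int. (-1) powi i * exp (of_int i * (of_int i - 1) / 2 * t + of_int i * u))
     = exp (- t / 8 + u / 2) * theta 0 u t"
  unfolding theta_term_0_eq[symmetric] theta_def by (rule infsum_cmult_right')

text \<open>Jacobi's triple product, kept as a limit of partial products so that residue classes of
  exponents can be regrouped while everything is still finite.\<close>

lemma theta_0_product:
  assumes t: "Re t < 0"
  shows "(\<lambda>n. (\<Prod>k<n. 1 - exp (of_nat (Suc k) * t - u)) * (\<Prod>k<n. 1 - exp (u + of_nat k * t)))
           \<longlonglongrightarrow> exp (- t / 8 + u / 2) * theta 0 u t / qq_powr 1 (exp t)"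
  unfolding finite_triple_product infsum_theta_0[symmetric]
proof (rule tendsto_sum_central_q_binom[OF norm_exp_less_1[OF t]])
  show "(\<lambda>i. norm ((-1) powi i * exp (of_int i * (of_int i - 1) / 2 * t + of_int i * u))) summable_on UNIV"
    unfolding theta_term_0_eq[symmetric] norm_mult
    by (intro summable_on_cmult_right abs_summable_theta_term t)
qed

text \<open>At nome parameter 5s the products for u = s and u = 2s run over the exponents congruent
  to 1, 4 and to 2, 3 modulo 5. Together with the multiples of 5 in (q^5;q^5) they fill all positive
  integers.\<close>

lemma theta_0_mult_theta_0:
  assumes s: "Re s < 0"
  shows "exp (s / 4) * theta 0 s (5 * s) * theta 0 (2 * s) (5 * s) = qq_powr 1 (exp s) * qq_powr 1 (exp (5 * s))"
proof -
  define q where "q = exp s"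
  have t: "Re (5 * s) < 0" using s by simp
  have q5: "exp (5 * s) = q ^ 5" by (simp add: q_def exp_of_nat_mult[symmetric])
  have q: "norm q < 1" "norm (q ^ 5) < 1" using norm_exp_less_1[OF s] norm_exp_less_1[OF t] by (simp_all add: q5[symmetric], simp add: q_def)
  define F where "F = (\<lambda>u n. (\<Prod>k<n. 1 - exp (of_nat (Suc k) * (5 * s) - u)) * (\<Prod>k<n. 1 - exp (u + of_nat k * (5 * s))))"
  have e: "exp (of_nat m * s) = q ^ m" for m by (simp add: q_def exp_of_nat_mult)
  have "F s n * F (2 * s) n * q_fact n (q ^ 5) = q_fact (5 * n) q" for n
  proof (induction n)
    case (Suc n)
    have F_Suc: "F u (Suc n) = F u n * (1 - exp (of_nat (Suc n) * (5 * s) - u)) * (1 - exp (u + of_nat n * (5 * s)))" for u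
      by (simp add: F_def mult_ac)
    have e1: "exp (of_nat (Suc n) * (5 * s) - s) = q ^ (5 * n + 4)" "exp (s + of_nat n * (5 * s)) = q ^ (5 * n + 1)"
      "exp (of_nat (Suc n) * (5 * s) - 2 * s) = q ^ (5 * n + 3)" "exp (2 * s + of_nat n * (5 * s)) = q ^ (5 * n + 2)"
      unfolding e[symmetric] by (simp_all add: algebra_simps)
    have q_Suc: "q_fact (Suc n) (q ^ 5) = q_fact n (q ^ 5) * (1 - q ^ (5 * n + 5))"
      by (simp add: q_fact_Suc power_mult[symmetric] power_add[symmetric] algebra_simps)
    have "q_fact (5 * Suc n) q = q_fact (5 * n) q * (1 - q ^ (5 * n + 1)) * (1 - q ^ (5 * n + 2))
        * (1 - q ^ (5 * n + 3)) * (1 - q ^ (5 * n + 4)) * (1 - q ^ (5 * n + 5))"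
      by (simp add: q_fact_Suc eval_nat_numeral)
    thus ?case unfolding F_Suc e1 q_Suc Suc[symmetric] by (simp only: mult_ac)
  qed (simp add: F_def)
  moreover have "(\<lambda>n. F s n * F (2 * s) n * q_fact n (q ^ 5)) \<longlonglongrightarrow>
      (exp (- (5 * s) / 8 + s / 2) * theta 0 s (5 * s) / qq_powr 1 (q ^ 5)) *
      (exp (- (5 * s) / 8 + 2 * s / 2) * theta 0 (2 * s) (5 * s) / qq_powr 1 (q ^ 5)) * qq_powr 1 (q ^ 5)"
    unfolding F_def q5[symmetric]
    by (intro tendsto_mult theta_0_product t q_fact_tendsto norm_exp_less_1)
  moreover have "filterlim (\<lambda>n::nat. 5 * n) at_top sequentially"
    by (rule filterlim_subseq) (simp add: strict_mono_def)
  hence "(\<lambda>n. q_fact (5 * n) q) \<longlonglongrightarrow> qq_powr 1 q"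
    by (rule filterlim_compose[OF q_fact_tendsto[OF q(1)]])
  ultimately have "(exp (- (5 * s) / 8 + s / 2) * theta 0 s (5 * s) / qq_powr 1 (q ^ 5)) *
      (exp (- (5 * s) / 8 + 2 * s / 2) * theta 0 (2 * s) (5 * s) / qq_powr 1 (q ^ 5)) * qq_powr 1 (q ^ 5) = qq_powr 1 q"
    using LIMSEQ_unique by simp
  moreover have "exp (- (5 * s) / 8 + s / 2) * exp (- (5 * s) / 8 + 2 * s / 2) = exp (s / 4)"
    by (simp add: exp_add[symmetric])
  ultimately show ?thesis
    unfolding q_def[symmetric] q5 by (simp add: field_simps) (metis mult.assoc mult.commute)
qed

text \<open>Jacobi's series for the cube of (p;p): the finite triple product is differentiated at u
  = 0 and only then the limit is taken. The derivative brings down i instead of i - 1/2, which is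
  harmless since \<open>theta 0 0 t\<close> is 0.\<close>

lemma theta_1_eq:
  assumes t: "Re t < 0"
  shows "theta 1 0 t = - exp (t / 8) * qq_powr 1 (exp t) ^ 3"
proof -
  define p where "p = exp t"
  have p: "norm p < 1" using norm_exp_less_1[OF t] by (simp add: p_def)
  define c where "c = (\<lambda>i::int. of_int i * ((-1) powi i * exp (of_int i * (of_int i - 1) / 2 * t)))"
  have c_eq: "c i = exp (- t / 8) * (theta_term 1 0 t i + 1/2 * theta_term 0 0 t i)" for i
    using theta_term_0_eq[of t 0 i]
    by (simp add: c_def theta_term_def field_simps)
  have c: "(\<lambda>i. norm (c i)) summable_on UNIV"
  proof (rule Infinite_Sum.abs_summable_on_comparison_test')
    show "(\<lambda>i. norm (exp (- t / 8)) * (norm (theta_term 1 0 t i) + 1/2 * norm (theta_term 0 0 t i))) summable_on UNIV"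
      by (intro summable_on_cmult_right summable_on_add abs_summable_theta_term t)
    show "norm (c i) \<le> norm (exp (- t / 8)) * (norm (theta_term 1 0 t i) + 1/2 * norm (theta_term 0 0 t i))" for i
      unfolding c_eq norm_mult
      by (intro mult_left_mono order_trans[OF norm_triangle_ineq]) (simp_all add: norm_mult)
  qed
  have "infsum c UNIV = exp (- t / 8) * (theta 1 0 t + 1/2 * theta 0 0 t)"
    unfolding c_eq theta_def
    by (subst infsum_cmult_right', subst infsum_add)
       (simp_all only: infsum_cmult_right' summable_on_cmult_right summable_theta_term t)
  hence sum_c: "infsum c UNIV = exp (- t / 8) * theta 1 0 t" by simp
  have fin: "(\<Sum>i = - int (Suc n)..int (Suc n). c i * q_binom p (2 * Suc n) (nat (int (Suc n) + i)))
      = - (q_fact (Suc n) p * q_fact n p)" for n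
  proof -
    define l where "l = (\<lambda>u. (\<Prod>k<Suc n. 1 - exp (of_nat (Suc k) * t - u)) * (\<Prod>k<Suc n. 1 - exp (u + of_nat k * t)))"
    \<comment> \<open>The product without its factor 1 - exp u, which vanishes at u = 0, so the
      derivative of the whole there is \<open>- H 0\<close>. Working with \<open>Suc n\<close>
      guarantees that this factor is present.\<close>
    define H where "H = (\<lambda>u. (\<Prod>k<Suc n. 1 - exp (of_nat (Suc k) * t - u)) * (\<Prod>k<n. 1 - exp (u + of_nat (Suc k) * t)))"
    define r where "r = (\<lambda>u. \<Sum>i = - int (Suc n)..int (Suc n). (-1) powi i * exp (of_int i * (of_int i - 1) / 2 * t + of_int i * u)
      * q_binom p (2 * Suc n) (nat (int (Suc n) + i)))"
    have lr: "l = r" unfolding l_def r_def p_def by (intro ext finite_triple_product)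
    have l_eq: "l = (\<lambda>u. (1 - exp u) * H u)"
      unfolding l_def H_def prod.lessThan_Suc_shift[of "\<lambda>k. 1 - exp (_ + of_nat k * t)"] by (simp add: mult_ac)
    have "H holomorphic_on UNIV" unfolding H_def by (intro holomorphic_intros)
    then obtain H' where H': "(H has_field_derivative H') (at 0)"
      by (auto simp: holomorphic_on_def field_differentiable_def)
    have e: "exp (of_nat (Suc k) * t) = p ^ Suc k" for k unfolding p_def exp_of_nat_mult ..
    have "H 0 = q_fact (Suc n) p * q_fact n p"
      unfolding H_def q_fact_def diff_zero add_0 e ..
    moreover have "(l has_field_derivative - H 0) (at 0)"
      unfolding l_eq by (rule derivative_eq_intros H' refl)+ simp
    moreover have "(r has_field_derivative (\<Sum>i = - int (Suc n)..int (Suc n). c i * q_binom p (2 * Suc n) (nat (int (Suc n) + i)))) (at 0)"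
      unfolding r_def c_def
      by (rule derivative_eq_intros refl)+ (simp add: mult_ac)
    ultimately show ?thesis unfolding lr using DERIV_unique by metis
  qed
  have "(\<lambda>n. \<Sum>i = - int (Suc n)..int (Suc n). c i * q_binom p (2 * Suc n) (nat (int (Suc n) + i)))
      \<longlonglongrightarrow> infsum c UNIV / qq_powr 1 p"
    using tendsto_sum_central_q_binom[OF p c, THEN LIMSEQ_Suc] .
  moreover have "(\<lambda>n. - (q_fact (Suc n) p * q_fact n p)) \<longlonglongrightarrow> - (qq_powr 1 p * qq_powr 1 p)"
    by (intro tendsto_intros q_fact_tendsto[OF p] LIMSEQ_Suc[OF q_fact_tendsto[OF p]])
  ultimately have "infsum c UNIV / qq_powr 1 p = - (qq_powr 1 p * qq_powr 1 p)"
    unfolding fin using LIMSEQ_unique by blast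
  hence "exp (- t / 8) * theta 1 0 t = - (qq_powr 1 p ^ 3)"
    unfolding sum_c by (simp add: field_simps power3_eq_cube)
  hence "exp (t / 8) * exp (- t / 8) * theta 1 0 t = - exp (t / 8) * qq_powr 1 p ^ 3"
    by (simp add: mult.assoc)
  thus ?thesis unfolding exp_add[symmetric] p_def by simp
qed

section \<open>Identification of the null value ratio with E_2\<close>

lemma has_field_derivative_log_qq:
  assumes p: "norm p < 1"
  obtains D where "((\<lambda>q. \<Sum>k. Ln (1 - q ^ Suc k)) has_field_derivative D) (at p)"
    "(\<lambda>k. - (of_nat (Suc k) * p ^ k / (1 - p ^ Suc k))) sums D"
proof -
  define f where "f = (\<lambda>n q. \<Sum>k<n. Ln (1 - q ^ Suc k) :: complex)"
  define f' where "f' = (\<lambda>n q. \<Sum>k<n. - (of_nat (Suc k) * q ^ k / (1 - q ^ Suc k)) :: complex)"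
  have "\<exists>g'. \<forall>x\<in>ball 0 1. ((\<lambda>q. \<Sum>k. Ln (1 - q ^ Suc k)) has_field_derivative g' x) (at x) \<and>
          ((\<lambda>n. f' n x) \<longlongrightarrow> g' x) sequentially"
  proof (rule has_complex_derivative_uniform_sequence[OF open_ball])
    show "(f n has_field_derivative f' n x) (at x)" if "x \<in> ball 0 1" for n x
      unfolding f_def f'_def
    proof (rule DERIV_sum)
      fix k
      have x: "norm x < 1" using that by simp
      show "((\<lambda>q. Ln (1 - q ^ Suc k)) has_field_derivative - (of_nat (Suc k) * x ^ k / (1 - x ^ Suc k))) (at x)"
        by (rule derivative_eq_intros refl | rule one_minus_in_slit[OF x])+
           (use one_minus_in_slit(2)[OF x, of k] in \<open>simp add: field_simps\<close>)
    qed
    fix x :: complex assume x: "x \<in> ball 0 1"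
    define d where "d = (1 - norm x) / 2"
    have d: "d > 0" and r: "0 < norm x + d" "norm x + d < 1"
      using x norm_ge_zero[of x] by (auto simp: d_def field_simps simp del: norm_ge_zero)
    have sub: "cball x d \<subseteq> cball 0 (norm x + d)"
      by (simp add: cball_subset_cball_iff)
    also have "\<dots> \<subseteq> ball 0 1"
      using r by auto
    finally show "\<exists>d>0. cball x d \<subseteq> ball 0 1 \<and>
        uniform_limit (cball x d) f (\<lambda>q. \<Sum>k. Ln (1 - q ^ Suc k)) sequentially"
      using d uniform_limit_on_subset[OF uniform_limit_log[OF r] sub] unfolding f_def by blast
  qed
  thus ?thesis using that p unfolding f'_def sums_def by force
qed

text \<open>Each Lambert term is a geometric series. The resulting double series converges
  absolutely and is regrouped by the value n + 1 = (k + 1)(m + 1), with divisor d = k + 1.\<close>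

lemma lambert_series:
  fixes p :: complex
  assumes p: "norm p < 1"
  shows "(\<lambda>n. of_nat (\<Sum>d | d dvd Suc n. d) * p ^ Suc n) sums
           (\<Sum>k. of_nat (Suc k) * p ^ Suc k / (1 - p ^ Suc k))"
proof -
  define f :: "nat \<times> nat \<Rightarrow> complex" where "f = (\<lambda>(k, m). of_nat (Suc k) * p ^ (Suc k * Suc m))"
  define r where "r = norm p"
  have r: "0 \<le> r" "r < 1" using p by (auto simp: r_def)
  have pk: "norm (p ^ Suc k) < 1" for k
    using p by (simp only: norm_power power_less_one_iff norm_ge_zero)
       (auto intro: power_less_one_iff[THEN iffD2])
  have geo: "((\<lambda>m. c * x ^ Suc m) has_sum c * x / (1 - x)) (UNIV :: nat set)"
    if "norm x < 1" for c x :: "'a :: {real_normed_field, banach}"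
  proof (rule norm_summable_imp_has_sum)
    show "summable (\<lambda>m. norm (c * x ^ Suc m))"
      using that by (auto simp: norm_mult norm_power intro!: summable_mult summable_geometric)
    show "(\<lambda>m. c * x ^ Suc m) sums (c * x / (1 - x))"
      using sums_mult[OF geometric_sums[OF that], of "c * x"] by (simp add: mult_ac)
  qed
  have inner: "((\<lambda>m. f (k, m)) has_sum of_nat (Suc k) * p ^ Suc k / (1 - p ^ Suc k)) UNIV" for k
    using geo[OF pk[of k], of "of_nat (Suc k)"] unfolding f_def prod.case power_mult .
  have inner_norm: "((\<lambda>m. norm (f (k, m))) has_sum real (Suc k) * r ^ Suc k / (1 - r ^ Suc k)) UNIV" for k
  proof -
    have "norm (r ^ Suc k) < 1" using pk[of k] by (simp only: norm_power r_def real_norm_def abs_norm_cancel power_abs)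
    from geo[OF this, of "real (Suc k)"] show ?thesis
      by (simp only: f_def prod.case norm_mult norm_power power_mult r_def norm_of_nat)
  qed
  have sm: "summable (\<lambda>k. real (Suc k) * r ^ Suc k / (1 - r ^ Suc k))"
  proof (rule summable_comparison_test'[where N = 0])
    have "summable (\<lambda>k. of_nat (Suc k) * r ^ k)"
      using r by (intro sums_summable[OF geometric_deriv_sums]) auto
    thus "summable (\<lambda>k. of_nat (Suc k) * r ^ k * (r / (1 - r)))" by (rule summable_mult2)
    show "norm (real (Suc k) * r ^ Suc k / (1 - r ^ Suc k)) \<le> of_nat (Suc k) * r ^ k * (r / (1 - r))" for k
    proof -
      have le: "r ^ Suc k \<le> r" using r by (simp add: mult_left_le power_le_one)
      have "real (Suc k) * r ^ Suc k / (1 - r ^ Suc k) \<le> real (Suc k) * r ^ Suc k / (1 - r)"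
        using le r by (intro divide_left_mono mult_nonneg_nonneg mult_pos_pos) auto
      moreover have "real (Suc k) * r ^ Suc k / (1 - r ^ Suc k) \<ge> 0"
        using le r by (intro divide_nonneg_nonneg mult_nonneg_nonneg) auto
      ultimately show ?thesis unfolding real_norm_def by (subst abs_of_nonneg) (simp_all add: mult_ac)
    qed
  qed
  have F: "f summable_on (UNIV \<times> UNIV)"
  proof (rule abs_summable_summable, subst Infinite_Sum.abs_summable_on_Sigma_iff, intro conjI ballI)
    show "(\<lambda>y. norm (f (x, y))) summable_on UNIV" for x
      using inner_norm by (rule has_sum_imp_summable)
    have eq: "(\<Sum>\<^sub>\<infinity>y. norm (f (k, y))) = real (Suc k) * r ^ Suc k / (1 - r ^ Suc k)" for k
      using inner_norm by (rule infsumI)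
    have "summable (\<lambda>k. norm (real (Suc k) * r ^ Suc k / (1 - r ^ Suc k)))"
    proof -
      have "r ^ Suc k \<le> 1" for k using r by (intro power_le_one) auto
      hence "(\<lambda>k. norm (real (Suc k) * r ^ Suc k / (1 - r ^ Suc k))) = (\<lambda>k. real (Suc k) * r ^ Suc k / (1 - r ^ Suc k))"
        using r by (intro ext, subst real_norm_def, subst abs_of_nonneg) auto
      thus ?thesis using sm by simp
    qed
    thus "(\<lambda>x. norm (\<Sum>\<^sub>\<infinity>y. norm (f (x, y)))) summable_on UNIV"
      unfolding eq by (intro norm_summable_imp_summable_on) (simp only: real_norm_def abs_idempotent)
  qed
  define S where "S = infsum f (UNIV \<times> UNIV)"
  have S: "(f has_sum S) (UNIV \<times> UNIV)" unfolding S_def by (rule has_sum_infsum[OF F])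
  have 1: "((\<lambda>k. of_nat (Suc k) * p ^ Suc k / (1 - p ^ Suc k)) has_sum S) UNIV"
    by (rule has_sum_SigmaD[OF S]) (rule inner)
  have "((\<lambda>(n, d). of_nat d * p ^ Suc n) has_sum S) (SIGMA n:UNIV. {d. d dvd Suc n}) \<longleftrightarrow> (f has_sum S) (UNIV \<times> UNIV)"
  proof (rule has_sum_reindex_bij_witness[where
      i = "\<lambda>(k, m). (Suc k * Suc m - 1, Suc k)" and j = "\<lambda>(n, d). (d - 1, Suc n div d - 1)"])
    fix a :: "nat \<times> nat" assume a: "a \<in> (SIGMA n:UNIV. {d. d dvd Suc n})"
    then obtain n d where nd: "a = (n, d)" "d dvd Suc n" by auto
    then obtain e where e: "Suc n = d * e" by (elim dvdE)
    then obtain d' e' where de: "d = Suc d'" "e = Suc e'" by (cases d; cases e) auto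
    have "Suc n div d = e" using e de by (simp del: mult_Suc mult_Suc_right)
    thus "(\<lambda>(k, m). (Suc k * Suc m - 1, Suc k)) ((\<lambda>(n, d). (d - 1, Suc n div d - 1)) a) = a"
      and "f ((\<lambda>(n, d). (d - 1, Suc n div d - 1)) a) = (case a of (n, d) \<Rightarrow> of_nat d * p ^ Suc n)"
      using nd de e unfolding f_def by (auto simp del: mult_Suc mult_Suc_right power_Suc)
  qed (auto simp: nonzero_mult_div_cancel_left simp del: mult_Suc mult_Suc_right)
  hence S2: "((\<lambda>(n, d). of_nat d * p ^ Suc n) has_sum S) (SIGMA n:UNIV. {d. d dvd Suc n})"
    using S by blast
  have 2: "((\<lambda>n. of_nat (\<Sum>d | d dvd Suc n. d) * p ^ Suc n) has_sum S) UNIV"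
  proof (rule has_sum_SigmaD[OF S2])
    fix n :: nat
    have fin: "finite {d. d dvd Suc n}" by (rule finite_divisors_nat) simp
    have "of_nat (\<Sum>d | d dvd Suc n. d) * p ^ Suc n = (\<Sum>d | d dvd Suc n. of_nat d * p ^ Suc n)"
      unfolding of_nat_sum sum_distrib_right ..
    thus "((\<lambda>d. case (n, d) of (n, d) \<Rightarrow> of_nat d * p ^ Suc n) has_sum of_nat (\<Sum>d | d dvd Suc n. d) * p ^ Suc n) {d. d dvd Suc n}"
      using has_sum_finite[OF fin, of "\<lambda>d. of_nat d * p ^ Suc n"] by simp
  qed
  have s1: "(\<lambda>k. of_nat (Suc k) * p ^ Suc k / (1 - p ^ Suc k)) sums S" by (rule has_sum_imp_sums[OF 1])
  show "(\<lambda>n. of_nat (\<Sum>d | d dvd Suc n. d) * p ^ Suc n) sums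
           (\<Sum>k. of_nat (Suc k) * p ^ Suc k / (1 - p ^ Suc k))"
    using has_sum_imp_sums[OF 2] s1 by (simp add: sums_iff)
qed

text \<open>Two evaluations of the t-derivative of \<open>theta 1 0 t\<close> are compared: the heat
  equation gives half of \<open>theta 3 0 t\<close>, and the product in \<open>theta_1_eq\<close>
  gives a Lambert series.\<close>

lemma theta_null_ratio_eq_E2:
  assumes t: "Re t < 0"
  shows "theta_null_ratio t = E2 (exp t)"
proof -
  define p where "p = exp t"
  have p: "norm p < 1" using norm_exp_less_1[OF t] by (simp add: p_def)
  define F where "F = (\<lambda>q. \<Sum>k. Ln (1 - q ^ Suc k) :: complex)"
  obtain D where D: "(F has_field_derivative D) (at p)"
    and D': "(\<lambda>k. - (of_nat (Suc k) * p ^ k / (1 - p ^ Suc k))) sums D"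
    using has_field_derivative_log_qq[OF p] unfolding F_def by blast
  have "(\<lambda>k. - (- (of_nat (Suc k) * p ^ k / (1 - p ^ Suc k)) * p)) sums - (D * p)"
    by (intro sums_minus sums_mult2 D')
  hence "(\<lambda>k. of_nat (Suc k) * p ^ Suc k / (1 - p ^ Suc k)) sums - (D * p)"
    by (simp add: mult_ac)
  hence E: "E2 p = 1 + 24 * (D * p)"
    using lambert_series[OF p] unfolding E2_def by (simp add: sums_iff)
  have J: "theta 1 0 x = - exp (x / 8) * exp (F (exp x)) ^ 3" if "Re x < 0" for x
    unfolding theta_1_eq[OF that] qq_powr_def F_def by simp
  have op: "open {x::complex. Re x < 0}" by (simp add: open_halfspace_Re_lt)
  have DF: "((\<lambda>x. F (exp x)) has_field_derivative D * exp t) (at t)"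
    using DERIV_chain2[where g = exp and x = t, OF D[unfolded p_def]] DERIV_exp by blast
  have DE: "((\<lambda>x. - exp (x / 8)) has_field_derivative - exp (t / 8) / 8) (at t)"
    by (auto intro!: derivative_eq_intros)
  have DX: "((\<lambda>x. exp (F (exp x)) ^ 3) has_field_derivative exp (F p) ^ 3 * (3 * (D * p))) (at t)"
    by (rule derivative_eq_intros DF refl)+ (simp add: p_def eval_nat_numeral)
  have "((\<lambda>x. - exp (x / 8) * exp (F (exp x)) ^ 3) has_field_derivative
      (- exp (t / 8) * exp (F p) ^ 3) * (1 / 8 + 3 * (D * p))) (at t)"
    by (rule DERIV_cong[OF DERIV_mult[OF DE DX]]) (simp add: p_def algebra_simps)
  hence "(theta 1 0 has_field_derivative (- exp (t / 8) * exp (F p) ^ 3) * (1 / 8 + 3 * (D * p))) (at t)"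
    by (rule has_field_derivative_transform_within_open[OF _ op]) (use t J in auto)
  hence d1: "(theta 1 0 has_field_derivative theta 1 0 t * (1 / 8 + 3 * (D * p))) (at t)"
    unfolding J[OF t] p_def .
  have "(theta 1 0 has_field_derivative theta 3 0 t / 2) (at t)"
    using has_field_derivative_theta[of 0 1 t 1 0 0] t by (simp add: eval_nat_numeral)
  hence "theta 3 0 t / 2 = theta 1 0 t * (1 / 8 + 3 * (D * p))"
    using d1 by (rule DERIV_unique)
  moreover have "theta 1 0 t \<noteq> 0" unfolding theta_1_eq[OF t] by simp
  ultimately have "theta_null_ratio t = 8 * (1 / 8 + 3 * (D * p))"
    unfolding theta_null_ratio_def by (simp add: field_simps)
  thus ?thesis unfolding p_def[symmetric] E by simp
qed

section \<open>Values at 5-torsion points\<close>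

text \<open>Exponentials and \<open>qq_powr\<close> never vanish, so the product formulas exclude
  zeros. This makes the points s and 2s generic.\<close>

lemma theta_0_nonzero:
  assumes s: "Re s < 0"
  shows "theta 0 s (5 * s) \<noteq> 0" "theta 0 (2 * s) (5 * s) \<noteq> 0" "theta 1 0 (5 * s) \<noteq> 0"
  using theta_0_mult_theta_0[OF s] theta_1_eq[of "5 * s"] s by auto

text \<open>Two u-derivatives of \<open>theta_period\<close>; the multiplier itself depends on u,
  whence the lower-order terms.\<close>

lemma theta_1_2_period:
  assumes t: "Re t < 0"
  shows "theta 1 (u + t) t = - exp (- t / 2 - u) * (theta 1 u t - theta 0 u t)"
    and "theta 2 (u + t) t = - exp (- t / 2 - u) * (theta 2 u t - 2 * theta 1 u t + theta 0 u t)"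
proof -
  have d: "((\<lambda>w. theta j (a + w) t) has_field_derivative theta (Suc j) (a + w) t) (at w)" for j a w
    using has_field_derivative_theta[of t 0 w j a 1] t by simp
  have d0: "(theta' has_field_derivative theta (Suc j) w t) (at w)" if "theta' = (\<lambda>w. theta j w t)" for j w theta'
    using d[of j 0 w] that by simp
  define E where "E = (\<lambda>w. - exp (- t / 2 - w) :: complex)"
  have E: "(E has_field_derivative - E w) (at w)" for w
    unfolding E_def by (rule derivative_eq_intros refl)+ simp
  have 0: "(\<lambda>w. theta 0 (t + w) t) = (\<lambda>w. E w * theta 0 w t)"
    unfolding E_def using theta_period[of _ t] by (simp add: add.commute)
  have r0: "((\<lambda>w. E w * theta 0 w t) has_field_derivative E w * (theta 1 w t - theta 0 w t)) (at w)" for w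
    by (rule derivative_eq_intros E d0 refl)+ (simp add: algebra_simps)
  have 1: "theta 1 (t + w) t = E w * (theta 1 w t - theta 0 w t)" for w
    using DERIV_unique[OF d[of 0 t w, unfolded 0] r0[of w]] by simp
  have r1: "((\<lambda>w. E w * (theta 1 w t - theta 0 w t)) has_field_derivative
      E w * (theta 2 w t - 2 * theta 1 w t + theta 0 w t)) (at w)" for w
    by (rule derivative_eq_intros E d0 refl)+ (simp add: algebra_simps numeral_2_eq_2)
  have 2: "theta 2 (t + w) t = E w * (theta 2 w t - 2 * theta 1 w t + theta 0 w t)" for w
    using DERIV_unique[OF d[of 1 t w, unfolded 1] r1[of w]] by (simp add: numeral_2_eq_2)
  show "theta 1 (u + t) t = - exp (- t / 2 - u) * (theta 1 u t - theta 0 u t)"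
    "theta 2 (u + t) t = - exp (- t / 2 - u) * (theta 2 u t - 2 * theta 1 u t + theta 0 u t)"
    using 1[of u] 2[of u] by (simp_all add: E_def add.commute)
qed

lemma dlog1_minus: "dlog1 (-u) t = - dlog1 u t"
  using theta_minus[of 0 u t] theta_minus[of 1 u t] by (simp add: dlog1_def theta_quot_def)

lemma dlog2_minus: "dlog2 (-u) t = dlog2 u t"
  using theta_minus[of 0 u t] theta_minus[of 1 u t] theta_minus[of 2 u t]
  by (simp add: dlog2_def theta_quot_def numeral_2_eq_2)

lemma dlog1_period:
  assumes "Re t < 0" "theta 0 u t \<noteq> 0"
  shows "dlog1 (u + t) t = dlog1 u t - 1"
  using assms(2) unfolding dlog1_def theta_quot_def theta_1_2_period(1)[OF assms(1)] theta_period
  by (simp add: field_simps)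

lemma dlog2_period:
  assumes "Re t < 0" "theta 0 u t \<noteq> 0"
  shows "dlog2 (u + t) t = dlog2 u t"
proof -
  have e: "theta_quot 2 (u + t) t = theta_quot 2 u t - 2 * theta_quot 1 u t + 1"
    using assms(2) unfolding theta_quot_def theta_1_2_period(2)[OF assms(1)] theta_period
    by (simp add: field_simps)
  have z: "theta_quot 1 (u + t) t = theta_quot 1 u t - 1"
    using dlog1_period[OF assms] unfolding dlog1_def .
  show ?thesis unfolding dlog2_def e z by algebra
qed

text \<open>
  The fifth powers of \<open>A\<close> and \<open>B\<close> as functions of \<open>s = 2\<pi>i\<tau>\<close>: \<open>(q;q)\<^sup>3\<close> has been eliminated from them
  through the product formula for \<open>\<theta>(s, 5s) \<theta>(2s, 5s)\<close>.
\<close>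

definition a_fun :: "complex \<Rightarrow> complex" where
  "a_fun s = - exp (- s) * (theta 0 s (5 * s))\<^sup>2 * theta 1 0 (5 * s) / theta 0 (2 * s) (5 * s) ^ 3"

definition b_fun :: "complex \<Rightarrow> complex" where
  "b_fun s = - exp (s / 2) * (theta 0 (2 * s) (5 * s))\<^sup>2 * theta 1 0 (5 * s) / theta 0 s (5 * s) ^ 3"

text \<open>With u = s, v = 2s and period t = 5s, the points u + v, u - v, 2u, 2v are again s or 2s
  up to sign and period. The addition formulas therefore close up: \<open>dlog1_sum\<close> and
  \<open>dlog1_diff\<close> become linear equations for the \<open>dlog1\<close> values,
  \<open>dlog1_addition\<close> gives two for the \<open>dlog2\<close> values, and
  \<open>dlog2_sum_1\<close> gives \<open>dlog4\<close>.\<close>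

lemma torsion_values:
  assumes s: "Re s < 0"
  defines "a \<equiv> a_fun s" and "b \<equiv> b_fun s"
  shows "10 * dlog1 s (5 * s) + 2 = - a - 3 * b"
    and "10 * dlog1 (2 * s) (5 * s) + 4 = 3 * a - b"
    and "12 * dlog2 s (5 * s) = theta_null_ratio (5 * s) - a\<^sup>2 - 6 * a * b - b\<^sup>2"
    and "12 * dlog2 (2 * s) (5 * s) = theta_null_ratio (5 * s) - a\<^sup>2 + 6 * a * b - b\<^sup>2"
    and "dlog3 s (5 * s) = - a * b\<^sup>2"
    and "dlog4 s (5 * s) = - a * b\<^sup>2 * (a + b)"
proof -
  define t where "t = 5 * s"
  have t: "Re t < 0" using s by (simp add: t_def)
  define T where "T = (\<lambda>u. theta 0 u t)"
  define J where "J = theta 1 0 t"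
  note nz = theta_0_nonzero[OF s, folded t_def]
  have nz': "T s \<noteq> 0" "T (2 * s) \<noteq> 0" "J \<noteq> 0" using nz by (simp_all add: T_def J_def)
  have T_minus: "T (- u) = - T u" for u using theta_minus[of 0 u t] by (simp add: T_def)
  have e3: "s + 2 * s = - (2 * s) + t" and e4: "2 * (2 * s) = - s + t" and em: "s - 2 * s = - s"
    by (simp_all add: t_def)
  have T3: "T (s + 2 * s) = exp (- s / 2) * T (2 * s)"
  proof -
    have "T (s + 2 * s) = - exp (- t / 2 - - (2 * s)) * T (- (2 * s))"
      unfolding e3 T_def by (rule theta_period)
    also have "- t / 2 - - (2 * s) = - s / 2" by (simp add: t_def)
    finally show ?thesis unfolding T_minus by simp
  qed
  have T4: "T (2 * (2 * s)) = exp (- 3 * s / 2) * T s"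
  proof -
    have "T (2 * (2 * s)) = - exp (- t / 2 - - s) * T (- s)"
      unfolding e4 T_def by (rule theta_period)
    also have "- t / 2 - - s = - 3 * s / 2" by (simp add: t_def)
    finally show ?thesis unfolding T_minus by simp
  qed
  have good: "theta_good s (2 * s) t"
    unfolding theta_good_def em using nz' t T3 T_minus[of s] by (simp add: T_def J_def)
  have "theta 0 (- (2 * s)) t \<noteq> 0" using nz' T_minus[of "2 * s"] by (simp add: T_def)
  note per = dlog1_period[OF t this] dlog2_period[OF t this]
  have Z3: "dlog1 (s + 2 * s) t = - dlog1 (2 * s) t - 1" and L3: "dlog2 (s + 2 * s) t = dlog2 (2 * s) t"
    unfolding e3 per dlog1_minus dlog2_minus by simp_all
  have Zm: "dlog1 (s - 2 * s) t = - dlog1 s t" and Lm: "dlog2 (s - 2 * s) t = dlog2 s t"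
    unfolding em dlog1_minus dlog2_minus by simp_all
  define d where "d = dlog2 s t - dlog2 (2 * s) t"
  have d0: "d \<noteq> 0" using dlog2_neq[OF good] by (simp add: d_def)
  have a_eq: "a = - exp (- s) * (T s)\<^sup>2 * J / T (2 * s) ^ 3"
    and b_eq: "b = - exp (s / 2) * (T (2 * s))\<^sup>2 * J / T s ^ 3"
    by (simp_all add: a_def b_def a_fun_def b_fun_def T_def J_def t_def)
  \<comment> \<open>\<open>theta_addition\<close> at this pair, where u + v = 3s is reduced by the
    quasi-period and u - v = -s by oddness.\<close>
  have d_eq: "d = - exp (- s / 2) * J\<^sup>2 / (T s * T (2 * s))"
  proof -
    have "T (s + 2 * s) * T (s - 2 * s) * J\<^sup>2 = (T s)\<^sup>2 * (T (2 * s))\<^sup>2 * d"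
      using theta_addition[OF t nz(1,2)] by (simp only: T_def J_def d_def)
    hence "T s * T (2 * s) * (d * (T s * T (2 * s)) + exp (- s / 2) * J\<^sup>2) = 0"
      unfolding T3 em T_minus by algebra
    hence "d * (T s * T (2 * s)) = - exp (- s / 2) * J\<^sup>2"
      using nz' by (simp add: add_eq_0_iff)
    thus ?thesis using nz' by (subst nonzero_eq_divide_eq) simp_all
  qed
  have ex: "exp (- s) * exp (s / 2) = exp (- s / 2)" "exp (s / 2) * exp (- s / 2) = 1"
    "exp (- s) * exp (- s / 2) = exp (- 3 * s / 2)"
    by (simp_all add: exp_add[symmetric])
  have ab: "a * b = - d"
  proof -
    have "a * b = (exp (- s) * exp (s / 2)) * ((T s)\<^sup>2 * J / T (2 * s) ^ 3 * ((T (2 * s))\<^sup>2 * J / T s ^ 3))"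
      unfolding a_eq b_eq by simp
    thus ?thesis unfolding ex d_eq using nz' by (simp add: field_simps eval_nat_numeral)
  qed
  \<comment> \<open>Duplication identifies \<open>b\<close> and \<open>a\<close> as the quotients
    \<open>dlog3 / d\<close> at s and 2s, the very right sides of \<open>dlog1_sum\<close> and, up
    to sign, \<open>dlog1_diff\<close>.\<close>
  have L1: "dlog3 s t = b * d"
  proof -
    have "b * d = (exp (s / 2) * exp (- s / 2)) * ((T (2 * s))\<^sup>2 * J / T s ^ 3 * (J\<^sup>2 / (T s * T (2 * s))))"
      unfolding d_eq b_eq by simp
    hence "b * d * T s ^ 4 = T (2 * s) * J ^ 3" unfolding ex using nz' by (simp add: field_simps eval_nat_numeral)
    also have "\<dots> = dlog3 s t * T s ^ 4" using dlog3_duplication[OF t nz(1)] by (simp only: T_def J_def)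
    finally show ?thesis using nz' by simp
  qed
  have L1': "dlog3 (2 * s) t = a * d"
  proof -
    have "a * d = (exp (- s) * exp (- s / 2)) * ((T s)\<^sup>2 * J / T (2 * s) ^ 3 * (J\<^sup>2 / (T s * T (2 * s))))"
      unfolding d_eq a_eq by simp
    hence "a * d * T (2 * s) ^ 4 = T (2 * (2 * s)) * J ^ 3" unfolding ex T4 using nz' by (simp add: field_simps eval_nat_numeral)
    also have "\<dots> = dlog3 (2 * s) t * T (2 * s) ^ 4" using dlog3_duplication[OF t nz(2)] by (simp only: T_def J_def)
    finally show ?thesis using nz' by simp
  qed
  have S: "- dlog1 (2 * s) t - 1 + - dlog1 s t - 2 * dlog1 s t = b"
    using dlog1_sum[OF good] d0 unfolding Z3 Zm L1 d_def[symmetric] by simp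
  have D: "- dlog1 (2 * s) t - 1 - - dlog1 s t - 2 * dlog1 (2 * s) t = - a"
    using dlog1_diff[OF good] d0 unfolding Z3 Zm L1' d_def[symmetric] by simp
  have D': "a = 1 + 3 * dlog1 (2 * s) t - dlog1 s t" using D by (simp add: algebra_simps)
  have S': "b = - dlog1 (2 * s) t - 1 - 3 * dlog1 s t" unfolding S[symmetric] by (simp add: algebra_simps)
  show "10 * dlog1 s (5 * s) + 2 = - a - 3 * b" and "10 * dlog1 (2 * s) (5 * s) + 4 = 3 * a - b"
    unfolding S' D' t_def[symmetric] by (simp_all add: algebra_simps)
  have M: "(- dlog1 (2 * s) t - 1 - dlog1 s t - dlog1 (2 * s) t)\<^sup>2 = theta_null_ratio t / 4 - dlog2 s t - 2 * dlog2 (2 * s) t"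
    using dlog1_addition(1)[OF good] unfolding Z3 L3 by simp
  have N: "(- dlog1 s t - dlog1 s t + dlog1 (2 * s) t)\<^sup>2 = theta_null_ratio t / 4 - 2 * dlog2 s t - dlog2 (2 * s) t"
    using dlog1_addition(2)[OF good] unfolding Zm Lm by simp
  \<comment> \<open>The bases of the two squares are half of b - a and of a + b, so the quadratic
    addition theorem becomes a linear system for the \<open>dlog2\<close> values.\<close>
  have 3: "2 * (- dlog1 (2 * s) t - 1 - dlog1 s t - dlog1 (2 * s) t) = b - a" "2 * (- dlog1 s t - dlog1 s t + dlog1 (2 * s) t) = a + b"
    unfolding S' D' by (simp_all add: algebra_simps)
  have M': "(b - a)\<^sup>2 = theta_null_ratio t - 4 * dlog2 s t - 8 * dlog2 (2 * s) t"
    unfolding 3[symmetric] power_mult_distrib M by simp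
  have N': "(a + b)\<^sup>2 = theta_null_ratio t - 8 * dlog2 s t - 4 * dlog2 (2 * s) t"
    unfolding 3[symmetric] power_mult_distrib N by simp
  show "12 * dlog2 s (5 * s) = theta_null_ratio (5 * s) - a\<^sup>2 - 6 * a * b - b\<^sup>2"
    "12 * dlog2 (2 * s) (5 * s) = theta_null_ratio (5 * s) - a\<^sup>2 + 6 * a * b - b\<^sup>2"
    using M' N' unfolding t_def[symmetric] by algebra+
  show "dlog3 s (5 * s) = - a * b\<^sup>2"
    using L1 ab unfolding t_def[symmetric] by algebra
  have "dlog2 (s + 2 * s) t + dlog2 (s - 2 * s) t - 2 * dlog2 s t = dlog4 s t / d - (b * d / d)\<^sup>2"
    using dlog2_sum_1[OF good] unfolding L1 d_def[symmetric] .
  hence "dlog2 (2 * s) t + dlog2 s t - 2 * dlog2 s t = dlog4 s t / d - b\<^sup>2"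
    unfolding L3 Lm using d0 by simp
  hence "dlog4 s t / d = b\<^sup>2 - d"
    unfolding d_def[symmetric] by (simp add: d_def algebra_simps)
  hence "dlog4 s t = d * (b\<^sup>2 - d)"
    using d0 by (simp add: divide_eq_eq mult.commute)
  thus "dlog4 s (5 * s) = - a * b\<^sup>2 * (a + b)"
    using ab unfolding t_def[symmetric] by algebra
qed

section \<open>Derivatives along the torsion lines\<close>

lemma has_field_derivative_line:
  assumes "((\<lambda>x. f (c * s + c * x) (5 * s + 5 * x)) has_field_derivative D) (at 0)"
  shows "((\<lambda>s::complex. f (c * s) (5 * s)) has_field_derivative (D::complex)) (at s)"
  using assms DERIV_shift[of "\<lambda>s. f (c * s) (5 * s)" D 0 s] by (simp add: algebra_simps)

text \<open>Along u = ks, t = 5s the direction is (k, 5), so the derivative combines k times the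
  u-derivative with five times the heat-equation term.\<close>

lemma has_field_derivative_theta_torsion:
  assumes s: "Re s < 0" and nz: "theta 0 (k * s) (5 * s) \<noteq> 0"
  shows "((\<lambda>s. theta 0 (k * s) (5 * s)) has_field_derivative theta 0 (k * s) (5 * s) *
     (k * dlog1 (k * s) (5 * s) + 5 / 2 * (dlog2 (k * s) (5 * s) + (dlog1 (k * s) (5 * s))\<^sup>2))) (at s)"
  by (rule has_field_derivative_line[where f = "theta 0"], rule has_field_derivative_theta_0) (use assms in auto)

lemma has_field_derivative_theta_1_torsion:
  assumes s: "Re s < 0"
  shows "((\<lambda>s. theta 1 0 (5 * s)) has_field_derivative theta 1 0 (5 * s) * (5 * theta_null_ratio (5 * s) / 8)) (at s)"
proof -
  have t: "Re (5 * s) < 0" using s by simp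
  have "((\<lambda>s. theta 1 (0 * s) (5 * s)) has_field_derivative theta 1 0 (5 * s) * (5 * theta_null_ratio (5 * s) / 8)) (at s)"
    by (rule has_field_derivative_line[where f = "theta 1"], rule DERIV_cong[OF has_field_derivative_theta_at_0])
       (use t theta_0_nonzero(3)[OF s] in \<open>simp_all add: theta_null_ratio_def eval_nat_numeral\<close>)
  thus ?thesis by simp
qed

text \<open>Logarithmic differentiation of the theta quotients leaves \<open>dlog1\<close> and
  \<open>dlog2\<close> at s and 2s, which \<open>torsion_values\<close> turns into polynomials in a,
  b and P.\<close>

lemma has_field_derivative_a_fun:
  assumes s: "Re s < 0"
  defines "a \<equiv> a_fun s" and "b \<equiv> b_fun s" and "P \<equiv> theta_null_ratio (5 * s)"
  shows "(a_fun has_field_derivative 1 / 12 * a * (- 5 * a\<^sup>2 - 66 * a * b + 7 * b\<^sup>2 + 5 * P)) (at s)"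
    and "(b_fun has_field_derivative 1 / 12 * b * (7 * a\<^sup>2 + 66 * a * b - 5 * b\<^sup>2 + 5 * P)) (at s)"
proof -
  note nz = theta_0_nonzero[OF s]
  define Z1 Z2 L1 L2 where "Z1 = dlog1 s (5 * s)" and "Z2 = dlog1 (2 * s) (5 * s)"
    and "L1 = dlog2 s (5 * s)" and "L2 = dlog2 (2 * s) (5 * s)"
  note D1 = has_field_derivative_theta_torsion[OF s, of 1, simplified, OF nz(1), folded Z1_def L1_def]
  note D2 = has_field_derivative_theta_torsion[OF s nz(2), folded Z2_def L2_def]
  note DJ = has_field_derivative_theta_1_torsion[OF s, folded P_def]
  note tv = torsion_values[OF s, folded a_def b_def P_def Z1_def Z2_def L1_def L2_def]
  have Z: "Z1 = (- a - 3 * b - 2) / 10" "Z2 = (3 * a - b - 4) / 10"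
    using tv(1,2) by (simp_all add: field_simps)
  have L: "L1 = (P - a\<^sup>2 - 6 * a * b - b\<^sup>2) / 12" "L2 = (P - a\<^sup>2 + 6 * a * b - b\<^sup>2) / 12"
    using tv(3,4) by (simp_all add: field_simps)
  define x1 x2 where "x1 = Z1 + 5 / 2 * (L1 + Z1\<^sup>2)" and "x2 = 2 * Z2 + 5 / 2 * (L2 + Z2\<^sup>2)"
  \<comment> \<open>The summands on the left are the contributions of the exponential, the squared
    theta value, the cubed theta value in the denominator, and
    \<open>theta 1 0 (5 * s)\<close>.\<close>
  have A: "- 1 + 2 * x1 - 3 * x2 + 5 * P / 8 = 1 / 12 * (- 5 * a\<^sup>2 - 66 * a * b + 7 * b\<^sup>2 + 5 * P)"
    and B: "1 / 2 + 2 * x2 - 3 * x1 + 5 * P / 8 = 1 / 12 * (7 * a\<^sup>2 + 66 * a * b - 5 * b\<^sup>2 + 5 * P)"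
    unfolding x1_def x2_def Z L by (simp_all add: field_simps power2_eq_square)
  define y z J where "y = theta 0 s (5 * s)" and "z = theta 0 (2 * s) (5 * s)" and "J = theta 1 0 (5 * s)"
  have yz: "y \<noteq> 0" "z \<noteq> 0" using nz by (simp_all add: y_def z_def)
  have Dy: "((\<lambda>s. theta 0 s (5 * s)) has_field_derivative y * x1) (at s)"
    using D1 by (simp add: y_def x1_def)
  have Dz: "((\<lambda>s. theta 0 (2 * s) (5 * s)) has_field_derivative z * x2) (at s)"
    using D2 by (simp add: z_def x2_def)
  have DJ': "((\<lambda>s. theta 1 0 (5 * s)) has_field_derivative J * (5 * P / 8)) (at s)"
    using DJ by (simp add: J_def)
  have Dy3: "((\<lambda>s. theta 0 s (5 * s) ^ 3) has_field_derivative y ^ 3 * (3 * x1)) (at s)"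
    by (rule derivative_eq_intros Dy refl)+ (simp add: y_def eval_nat_numeral)
  have Dz3: "((\<lambda>s. theta 0 (2 * s) (5 * s) ^ 3) has_field_derivative z ^ 3 * (3 * x2)) (at s)"
    by (rule derivative_eq_intros Dz refl)+ (simp add: z_def eval_nat_numeral)
  have Na: "((\<lambda>s. - exp (- s) * (theta 0 s (5 * s))\<^sup>2 * theta 1 0 (5 * s)) has_field_derivative
      - exp (- s) * y\<^sup>2 * J * (- 1 + 2 * x1 + 5 * P / 8)) (at s)"
    by (rule derivative_eq_intros Dy DJ' refl)+ (simp add: y_def J_def algebra_simps power2_eq_square)
  have De: "((\<lambda>s. - exp (s / 2)) has_field_derivative - exp (s / 2) * (1 / 2)) (at s)"
    by (auto intro!: derivative_eq_intros)
  have Nb: "((\<lambda>s. - exp (s / 2) * (theta 0 (2 * s) (5 * s))\<^sup>2 * theta 1 0 (5 * s)) has_field_derivative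
      - exp (s / 2) * z\<^sup>2 * J * (1 / 2 + 2 * x2 + 5 * P / 8)) (at s)"
    by (rule derivative_eq_intros De Dz DJ' refl)+ (simp add: z_def J_def algebra_simps power2_eq_square)
  have quot: "(n * w * d - n * (d * v)) / (d * d) = n / d * (w - v)" if "d \<noteq> 0" for n w d v :: complex
    using that by (simp add: field_simps)
  have "(a_fun has_field_derivative a * ((- 1 + 2 * x1 + 5 * P / 8) - 3 * x2)) (at s)"
    unfolding a_def a_fun_def y_def[symmetric] z_def[symmetric] J_def[symmetric]
    by (rule DERIV_cong[OF DERIV_divide[OF Na Dz3]])
       (use yz in \<open>simp add: z_def\<close>, unfold y_def[symmetric] z_def[symmetric] J_def[symmetric], rule quot, use yz in simp)
  also have "(- 1 + 2 * x1 + 5 * P / 8) - 3 * x2 = 1 / 12 * (- 5 * a\<^sup>2 - 66 * a * b + 7 * b\<^sup>2 + 5 * P)"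
    using A by (simp add: algebra_simps)
  finally show "(a_fun has_field_derivative 1 / 12 * a * (- 5 * a\<^sup>2 - 66 * a * b + 7 * b\<^sup>2 + 5 * P)) (at s)"
    by (simp add: mult_ac)
  have "(b_fun has_field_derivative b * ((1 / 2 + 2 * x2 + 5 * P / 8) - 3 * x1)) (at s)"
    unfolding b_def b_fun_def y_def[symmetric] z_def[symmetric] J_def[symmetric]
    by (rule DERIV_cong[OF DERIV_divide[OF Nb Dy3]])
       (use yz in \<open>simp add: y_def\<close>, unfold y_def[symmetric] z_def[symmetric] J_def[symmetric], rule quot, use yz in simp)
  also have "(1 / 2 + 2 * x2 + 5 * P / 8) - 3 * x1 = 1 / 12 * (7 * a\<^sup>2 + 66 * a * b - 5 * b\<^sup>2 + 5 * P)"
    using B by (simp add: algebra_simps)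
  finally show "(b_fun has_field_derivative 1 / 12 * b * (7 * a\<^sup>2 + 66 * a * b - 5 * b\<^sup>2 + 5 * P)) (at s)"
    by (simp add: mult_ac)
qed

text \<open>The torsion value of \<open>dlog2\<close> at s, solved for P, gives P = 12
  \<open>dlog2\<close> + a^2 + 6ab + b^2. Its derivative involves only \<open>dlog1\<close> to
  \<open>dlog4\<close> at s and the derivatives of a and b, all of them known.\<close>

lemma has_field_derivative_theta_null_ratio:
  assumes s: "Re s < 0"
  defines "a \<equiv> a_fun s" and "b \<equiv> b_fun s" and "P \<equiv> theta_null_ratio (5 * s)"
  shows "((\<lambda>s. theta_null_ratio (5 * s)) has_field_derivative
     5 / 12 * (P\<^sup>2 - b ^ 4 + 12 * b ^ 3 * a - 14 * b\<^sup>2 * a\<^sup>2 - 12 * b * a ^ 3 - a ^ 4)) (at s)"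
proof -
  note nz = theta_0_nonzero[OF s]
  have t: "Re (5 * s) < 0" using s by simp
  note tv = torsion_values[OF s, folded a_def b_def P_def]
  note Da = has_field_derivative_a_fun[OF s, folded a_def b_def P_def]
  have "((\<lambda>s. dlog2 (1 * s) (5 * s)) has_field_derivative
      (1 * dlog3 s (5 * s) + 5 * (dlog4 s (5 * s) / 2 + (dlog2 s (5 * s))\<^sup>2 + dlog1 s (5 * s) * dlog3 s (5 * s)))) (at s)"
    by (rule has_field_derivative_line[where f = dlog2], rule DERIV_cong[OF has_field_derivative_dlog2])
       (use t nz(1) in simp_all)
  hence DL: "((\<lambda>s. dlog2 s (5 * s)) has_field_derivative
      (dlog3 s (5 * s) + 5 * (dlog4 s (5 * s) / 2 + (dlog2 s (5 * s))\<^sup>2 + dlog1 s (5 * s) * dlog3 s (5 * s)))) (at s)"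
    by simp
  have Z: "dlog1 s (5 * s) = (- a - 3 * b - 2) / 10"
    using tv(1) by (simp add: field_simps)
  have L: "dlog2 s (5 * s) = (P - a\<^sup>2 - 6 * a * b - b\<^sup>2) / 12"
    using tv(3) by (simp add: field_simps)
  have "((\<lambda>s. 12 * dlog2 s (5 * s) + (a_fun s)\<^sup>2 + 6 * a_fun s * b_fun s + (b_fun s)\<^sup>2) has_field_derivative
      5 / 12 * (P\<^sup>2 - b ^ 4 + 12 * b ^ 3 * a - 14 * b\<^sup>2 * a\<^sup>2 - 12 * b * a ^ 3 - a ^ 4)) (at s)"
    by (rule derivative_eq_intros DL Da refl)+
       (unfold tv(5,6) Z L a_def[symmetric] b_def[symmetric], simp add: field_simps eval_nat_numeral)
  moreover have "12 * dlog2 x (5 * x) + (a_fun x)\<^sup>2 + 6 * a_fun x * b_fun x + (b_fun x)\<^sup>2 = theta_null_ratio (5 * x)"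
    if "Re x < 0" for x using torsion_values(3)[OF that] by simp
  moreover have "open {x::complex. Re x < 0}" by (simp add: open_halfspace_Re_lt)
  ultimately show ?thesis
    by (elim has_field_derivative_transform_within_open) (use s in auto)
qed

section \<open>Identification of A and B with theta values\<close>

lemma theta_series_eq_A:
  "(\<Sum>\<^sub>\<infinity>n::int. (-1) powi n * exp s powi ((5 * n\<^sup>2 - 3 * n) div 2)) = exp (- s / 8) * theta 0 s (5 * s)"
proof -
  \<comment> \<open>Here 5n(n-1)/2 + n = (5n^2 - 3n)/2, which singles out u = s and t = 5s; the
    integer division by 2 is exact. For B the linear term 2n gives u = 2s.\<close>
  have "exp s powi ((5 * n\<^sup>2 - 3 * n) div 2) = exp (of_int n * (of_int n - 1) / 2 * (5 * s) + of_int n * s)" for n :: int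
  proof -
    have "even (5 * n\<^sup>2 - 3 * n)" by simp
    then obtain k where k: "5 * n\<^sup>2 - 3 * n = 2 * k" by (elim evenE)
    have "2 * of_int k = (5 * (of_int n)\<^sup>2 - 3 * of_int n :: complex)"
      using arg_cong[OF k, of "of_int :: int \<Rightarrow> complex"] by simp
    hence kk: "of_int k = ((5 * (of_int n)\<^sup>2 - 3 * of_int n) / 2 :: complex)" by (simp add: field_simps)
    have "of_int k * s = of_int n * (of_int n - 1) / 2 * (5 * s) + of_int n * s"
      unfolding kk by (simp add: field_simps power2_eq_square)
    thus ?thesis unfolding k by (simp add: exp_power_int)
  qed
  thus ?thesis using infsum_theta_0[of "5 * s" s] by simp
qed

lemma theta_series_eq_B:
  "(\<Sum>\<^sub>\<infinity>n::int. (-1) powi n * exp s powi ((5 * n\<^sup>2 - n) div 2)) = exp (3 * s / 8) * theta 0 (2 * s) (5 * s)"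
proof -
  have "exp s powi ((5 * n\<^sup>2 - n) div 2) = exp (of_int n * (of_int n - 1) / 2 * (5 * s) + of_int n * (2 * s))" for n :: int
  proof -
    have "even (5 * n\<^sup>2 - n)" by simp
    then obtain k where k: "5 * n\<^sup>2 - n = 2 * k" by (elim evenE)
    have "2 * of_int k = (5 * (of_int n)\<^sup>2 - of_int n :: complex)"
      using arg_cong[OF k, of "of_int :: int \<Rightarrow> complex"] by simp
    hence kk: "of_int k = ((5 * (of_int n)\<^sup>2 - of_int n) / 2 :: complex)" by (simp add: field_simps)
    have "of_int k * s = of_int n * (of_int n - 1) / 2 * (5 * s) + of_int n * (2 * s)"
      unfolding kk by (simp add: field_simps power2_eq_square)
    thus ?thesis unfolding k by (simp add: exp_power_int)
  qed
  thus ?thesis using infsum_theta_0[of "5 * s" "2 * s"] by simp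
qed

definition A_exp :: "complex \<Rightarrow> complex" where
  "A_exp s = exp (s / 5) * qq_powr (-3/5) (exp s) * (exp (- s / 8) * theta 0 s (5 * s))"

definition B_exp :: "complex \<Rightarrow> complex" where
  "B_exp s = qq_powr (-3/5) (exp s) * (exp (3 * s / 8) * theta 0 (2 * s) (5 * s))"

lemma A_fun_eq: "A_fun \<tau> = A_exp (2 * of_real pi * \<i> * \<tau>)"
  unfolding A_fun_def A_exp_def nome_def Let_def theta_series_eq_A ..

lemma B_fun_eq: "B_fun \<tau> = B_exp (2 * of_real pi * \<i> * \<tau>)"
  unfolding B_fun_def B_exp_def nome_def Let_def theta_series_eq_B ..

text \<open>The fifth power of the fractional factor is (q;q)^(-3). It cancels against the cube of
  \<open>theta_0_mult_theta_0\<close>, and the remaining (q^5;q^5)^3 is a multiple of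
  \<open>theta 1 0 (5 * s)\<close>.\<close>

lemma qq_powr_exp_fifth:
  assumes s: "Re s < 0"
  shows "qq_powr (-3/5) (exp s) ^ 5 * exp (3 * s / 4) * (theta 0 s (5 * s) * theta 0 (2 * s) (5 * s)) ^ 3
     = - exp (- 5 * s / 8) * theta 1 0 (5 * s)"
proof -
  define Q where "Q = qq_powr 1 (exp s)"
  have t: "Re (5 * s) < 0" using s by simp
  have q5: "qq_powr (-3/5) (exp s) ^ 5 * Q ^ 3 = 1"
    using qq_powr_fifth[OF norm_exp_less_1[OF s]] qq_powr_of_nat[OF norm_exp_less_1[OF s], of 1]
    by (simp add: Q_def)
  have "exp (3 * s / 4) * (theta 0 s (5 * s) * theta 0 (2 * s) (5 * s)) ^ 3
      = (exp (s / 4) * theta 0 s (5 * s) * theta 0 (2 * s) (5 * s)) ^ 3"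
    by (simp add: power_mult_distrib exp_of_nat_mult[symmetric])
  also have "\<dots> = Q ^ 3 * qq_powr 1 (exp (5 * s)) ^ 3"
    unfolding theta_0_mult_theta_0[OF s] Q_def by (simp add: power_mult_distrib)
  finally have "qq_powr (-3/5) (exp s) ^ 5 * exp (3 * s / 4) * (theta 0 s (5 * s) * theta 0 (2 * s) (5 * s)) ^ 3
      = (qq_powr (-3/5) (exp s) ^ 5 * Q ^ 3) * qq_powr 1 (exp (5 * s)) ^ 3"
    by (simp only: mult.assoc)
  also have "\<dots> = (exp (- 5 * s / 8) * exp (5 * s / 8)) * qq_powr 1 (exp (5 * s)) ^ 3"
    unfolding q5 exp_add[symmetric] by simp
  also have "\<dots> = - exp (- 5 * s / 8) * theta 1 0 (5 * s)"
    unfolding theta_1_eq[OF t] by simp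
  finally show ?thesis .
qed

lemma A_exp_fifth:
  assumes s: "Re s < 0"
  shows "A_exp s ^ 5 = a_fun s"
proof -
  define y z where "y = theta 0 s (5 * s)" and "z = theta 0 (2 * s) (5 * s)"
  have z: "z \<noteq> 0" using theta_0_nonzero[OF s] by (simp add: z_def)
  have e: "exp (3 * s / 8) = exp (- (3 * s / 8)) * exp (3 * s / 4)"
    "exp (- (3 * s / 8)) * exp (- 5 * s / 8) = exp (- s)" by (simp_all add: exp_add[symmetric])
  have E: "(exp (s / 5) * exp (- s / 8)) ^ 5 = exp (3 * s / 8)"
    by (simp add: exp_of_nat_mult[symmetric] exp_add[symmetric])
  have "A_exp s ^ 5 = (exp (s / 5) * exp (- s / 8)) ^ 5 * qq_powr (-3/5) (exp s) ^ 5 * y ^ 5"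
    unfolding A_exp_def y_def by (simp only: power_mult_distrib mult_ac)
  hence "A_exp s ^ 5 * z ^ 3 = exp (3 * s / 8) * qq_powr (-3/5) (exp s) ^ 5 * y ^ 5 * z ^ 3"
    unfolding E by simp
  \<comment> \<open>The splitting y^5 z^3 = y^2 (yz)^3 isolates the combination evaluated by
    \<open>qq_powr_exp_fifth\<close>; for B the roles of y and z are exchanged.\<close>
  also have "\<dots> = exp (- (3 * s / 8)) * y\<^sup>2 * (qq_powr (-3/5) (exp s) ^ 5 * exp (3 * s / 4) * (y * z) ^ 3)"
    unfolding e by (simp add: power_mult_distrib eval_nat_numeral)
  also have "\<dots> = - (exp (- (3 * s / 8)) * exp (- 5 * s / 8)) * y\<^sup>2 * theta 1 0 (5 * s)"
    unfolding y_def z_def qq_powr_exp_fifth[OF s] by simp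
  also have "\<dots> = a_fun s * z ^ 3"
    unfolding e a_fun_def using z by (simp add: y_def z_def)
  finally show ?thesis using z by simp
qed

lemma B_exp_fifth:
  assumes s: "Re s < 0"
  shows "B_exp s ^ 5 = b_fun s"
proof -
  define y z where "y = theta 0 s (5 * s)" and "z = theta 0 (2 * s) (5 * s)"
  have y: "y \<noteq> 0" using theta_0_nonzero[OF s] by (simp add: y_def)
  have e: "exp (15 * s / 8) = exp (9 * s / 8) * exp (3 * s / 4)"
    "exp (9 * s / 8) * exp (- 5 * s / 8) = exp (s / 2)" by (simp_all add: exp_add[symmetric])
  have "exp (3 * s / 8) ^ 5 = exp (15 * s / 8)"
    by (simp add: exp_of_nat_mult[symmetric])
  hence "B_exp s ^ 5 * y ^ 3 = exp (15 * s / 8) * qq_powr (-3/5) (exp s) ^ 5 * z ^ 5 * y ^ 3"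
    unfolding B_exp_def z_def by (simp only: power_mult_distrib mult_ac)
  also have "\<dots> = exp (9 * s / 8) * z\<^sup>2 * (qq_powr (-3/5) (exp s) ^ 5 * exp (3 * s / 4) * (y * z) ^ 3)"
    unfolding e by (simp add: power_mult_distrib eval_nat_numeral)
  also have "\<dots> = - (exp (9 * s / 8) * exp (- 5 * s / 8)) * z\<^sup>2 * theta 1 0 (5 * s)"
    unfolding y_def z_def qq_powr_exp_fifth[OF s] by simp
  also have "\<dots> = b_fun s * y ^ 3"
    unfolding e b_fun_def using y by (simp add: y_def z_def)
  finally show ?thesis using y by simp
qed

lemma AB_exp_nonzero:
  assumes "Re s < 0"
  shows "A_exp s \<noteq> 0" "B_exp s \<noteq> 0"
  using theta_0_nonzero[OF assms] by (auto simp: A_exp_def B_exp_def)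

text \<open>Only the existence of the derivatives is needed here; their values follow from the fifth
  powers, so the derivative of \<open>qq_powr (-3/5)\<close> is never computed.\<close>

lemma AB_exp_differentiable:
  assumes s: "Re s < 0"
  shows "A_exp field_differentiable at s" "B_exp field_differentiable at s"
proof -
  have "qq_powr (-3/5) field_differentiable at (exp s)"
    using holomorphic_on_imp_differentiable_at[OF holomorphic_qq_powr[of "-3/5"] open_ball] norm_exp_less_1[OF s] by simp
  then obtain Q' where Q': "(qq_powr (-3/5) has_field_derivative Q') (at (exp s))"
    by (auto simp: field_differentiable_def)
  have Q: "((\<lambda>s. qq_powr (-3/5) (exp s)) has_field_derivative Q' * exp s) (at s)"
    using DERIV_chain2[where g = exp and x = s, OF Q'] DERIV_exp by blast
  have th: "(\<lambda>s. theta 0 (k * s) (5 * s)) field_differentiable at s" if "theta 0 (k * s) (5 * s) \<noteq> 0" for k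
    using has_field_derivative_theta_torsion[OF s that] by (auto simp: field_differentiable_def)
  have "(\<lambda>s. qq_powr (-3/5) (exp s)) field_differentiable at s"
    using Q by (auto simp: field_differentiable_def)
  moreover have "(\<lambda>s::complex. exp (s / 5)) field_differentiable at s" "(\<lambda>s::complex. exp (- s / 8)) field_differentiable at s"
    "(\<lambda>s::complex. exp (3 * s / 8)) field_differentiable at s"
    unfolding field_differentiable_def by (rule exI, (rule derivative_eq_intros refl zero_neq_numeral[symmetric] | simp)+)+
  ultimately show "A_exp field_differentiable at s" "B_exp field_differentiable at s"
    using th[of 1] th[of 2] theta_0_nonzero[OF s] unfolding A_exp_def B_exp_def
    by (auto intro!: field_differentiable_mult)
qed

text \<open>Differentiating f^5 = g and cancelling f^4 determines the derivative of f without
  choosing a root. The logarithmic derivative is divided by 5, which turns the 1/12 of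
  \<open>has_field_derivative_a_fun\<close> into 1/60.\<close>

lemma fifth_root_deriv:
  fixes f g :: "complex \<Rightarrow> complex"
  assumes f: "f field_differentiable at s" and nz: "f s \<noteq> 0" and S: "open S" "s \<in> S"
    and eq: "\<And>x. x \<in> S \<Longrightarrow> f x ^ 5 = g x"
    and g: "(g has_field_derivative f s ^ 5 * c) (at s)"
  shows "(f has_field_derivative f s * c / 5) (at s)"
proof -
  obtain D where D: "(f has_field_derivative D) (at s)"
    using f by (auto simp: field_differentiable_def)
  have "((\<lambda>x. f x ^ 5) has_field_derivative 5 * f s ^ 4 * D) (at s)"
    by (rule derivative_eq_intros D refl)+ simp
  hence "(g has_field_derivative 5 * f s ^ 4 * D) (at s)"
    by (rule has_field_derivative_transform_within_open[OF _ S eq])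
  hence "5 * f s ^ 4 * D = f s ^ 5 * c" using g by (rule DERIV_unique)
  hence "f s ^ 4 * (5 * D - f s * c) = 0" by (simp add: eval_nat_numeral algebra_simps)
  hence "5 * D = f s * c" using nz by simp
  hence eq': "D = f s * c / 5" by (simp add: field_simps)
  show ?thesis using D unfolding eq' .
qed

text \<open>The chain-rule factor 2 pi i cancels the one in \<open>qD\<close>, so \<open>qD\<close>
  is d/ds in the variable s = 2 pi i \<tau>. Differentiability is recorded as well, since the value
  of \<open>deriv\<close> is meaningful only with it.\<close>

lemma qD_nome:
  assumes "\<And>\<tau>. Im \<tau> > 0 \<Longrightarrow> F \<tau> = f (2 * of_real pi * \<i> * \<tau>)" and \<tau>: "Im \<tau> > 0"
    and "(f has_field_derivative D) (at (2 * of_real pi * \<i> * \<tau>))"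
  shows "F field_differentiable at \<tau>" "qD F \<tau> = D"
proof -
  have op: "open {\<tau>. Im \<tau> > 0}" by (simp add: open_halfspace_Im_gt)
  have "((\<lambda>\<tau>. 2 * of_real pi * \<i> * \<tau>) has_field_derivative 2 * of_real pi * \<i>) (at \<tau>)"
    by (auto intro!: derivative_eq_intros)
  with assms(3) have "((\<lambda>\<tau>. f (2 * of_real pi * \<i> * \<tau>)) has_field_derivative D * (2 * of_real pi * \<i>)) (at \<tau>)"
    by (rule DERIV_chain2)
  hence F: "(F has_field_derivative D * (2 * of_real pi * \<i>)) (at \<tau>)"
    by (rule has_field_derivative_transform_within_open[OF _ op]) (use assms in auto)
  thus "F field_differentiable at \<tau>" by (auto simp: field_differentiable_def)
  show "qD F \<tau> = D" unfolding qD_def DERIV_imp_deriv[OF F] by simp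
qed

theorem theorem1p6:
  fixes \<tau> A B P :: complex
  assumes "Im \<tau> > 0"
  assumes "A = A_fun \<tau>" and "B = B_fun \<tau>" and "P = P_fun \<tau>"
  shows "(A_fun field_differentiable at \<tau> \<and>
          B_fun field_differentiable at \<tau> \<and>
          P_fun field_differentiable at \<tau>) \<and>
         qD A_fun \<tau> = 1/60 * A * (-5 * A^10 - 66 * A^5 * B^5 + 7 * B^10 + 5 * P) \<and>
         qD B_fun \<tau> = 1/60 * B * (7 * A^10 + 66 * A^5 * B^5 - 5 * B^10 + 5 * P) \<and>
         qD P_fun \<tau> = 5/12 * (P^2 - B^20 + 12 * B^15 * A^5 - 14 * B^10 * A^10
                                - 12 * B^5 * A^15 - A^20)"
proof -
  define s where "s = 2 * of_real pi * \<i> * \<tau>"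
  have Re_neg: "Re (2 * of_real pi * \<i> * \<tau>) < 0" if "Im \<tau> > 0" for \<tau>
    using that by simp
  have s: "Re s < 0" using Re_neg[OF assms(1)] by (simp only: s_def)
  have op: "open {x::complex. Re x < 0}" "s \<in> {x. Re x < 0}" using s by (simp_all add: open_halfspace_Re_lt)
  have P_eq: "P_fun \<tau> = theta_null_ratio (5 * (2 * of_real pi * \<i> * \<tau>))" if "Im \<tau> > 0" for \<tau>
  proof -
    have t: "Re (5 * (2 * of_real pi * \<i> * \<tau>)) < 0" using that by simp
    have "exp (5 * (2 * of_real pi * \<i> * \<tau>)) = nome \<tau> ^ 5"
      unfolding nome_def by (simp add: exp_of_nat_mult[symmetric])
    thus ?thesis unfolding theta_null_ratio_eq_E2[OF t] P_fun_def by simp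
  qed
  have A: "A = A_exp s" and B: "B = B_exp s" and P: "P = theta_null_ratio (5 * s)"
    using assms A_fun_eq B_fun_eq P_eq by (simp_all add: s_def)
  have a: "a_fun s = A ^ 5" and b: "b_fun s = B ^ 5"
    using A_exp_fifth[OF s] B_exp_fifth[OF s] A B by simp_all
  note ab = has_field_derivative_a_fun[OF s, unfolded a b P[symmetric]]
  have pw: "(A ^ 5)\<^sup>2 = A ^ 10" "(A ^ 5) ^ 3 = A ^ 15" "(A ^ 5) ^ 4 = A ^ 20"
    "(B ^ 5)\<^sup>2 = B ^ 10" "(B ^ 5) ^ 3 = B ^ 15" "(B ^ 5) ^ 4 = B ^ 20"
    by (simp_all add: power_mult[symmetric])
  have DA: "(A_exp has_field_derivative A * (1 / 12 * (- 5 * A ^ 10 - 66 * A ^ 5 * B ^ 5 + 7 * B ^ 10 + 5 * P)) / 5) (at s)"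
    unfolding A
    by (rule fifth_root_deriv[OF AB_exp_differentiable(1)[OF s] AB_exp_nonzero(1)[OF s] op])
       (use A_exp_fifth ab(1) in \<open>auto simp: A[symmetric] pw mult_ac\<close>)
  have DB: "(B_exp has_field_derivative B * (1 / 12 * (7 * A ^ 10 + 66 * A ^ 5 * B ^ 5 - 5 * B ^ 10 + 5 * P)) / 5) (at s)"
    unfolding B
    by (rule fifth_root_deriv[OF AB_exp_differentiable(2)[OF s] AB_exp_nonzero(2)[OF s] op])
       (use B_exp_fifth ab(2) in \<open>auto simp: B[symmetric] pw mult_ac\<close>)
  have DP: "((\<lambda>s. theta_null_ratio (5 * s)) has_field_derivative
     5/12 * (P^2 - B^20 + 12 * B^15 * A^5 - 14 * B^10 * A^10 - 12 * B^5 * A^15 - A^20)) (at s)"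
    using has_field_derivative_theta_null_ratio[OF s, unfolded a b P[symmetric] pw] .
  note QA = qD_nome[of A_fun A_exp, OF A_fun_eq assms(1) DA[unfolded s_def]]
  note QB = qD_nome[of B_fun B_exp, OF B_fun_eq assms(1) DB[unfolded s_def]]
  note QP = qD_nome[of P_fun "\<lambda>s. theta_null_ratio (5 * s)", OF P_eq assms(1) DP[unfolded s_def]]
  show ?thesis
    using QA QB QP by simp
qed

end
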